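(* Let $K$ be an algebraically closed field, $n\geqslant 3$, $i\in\{0,\ldots,n-2\}$, and let $M_i=\mathcal{M}^0(S_i,A_i,B_i;P_i)$ be the semigroup of matrix type over the infinite cyclic semigroup $S_i$ generated by $s_i$ described in the context. Then for every $\lambda\in K^*$ there exists a unique (up to equivalence) irreducible representation $\psi_\lambda:K_0[M_i]\to M_r(K)$, for some $1\leqslant r\leqslant |A_i|$, that is induced by the irreducible representation $s_i\mapsto\lambda$ of the infinite cyclic group generated by $s_i$.
   Context: For $n\geqslant 3$, $C_n$ is the Hecke--Kiselman monoid of the oriented cycle $1\to 2\to\cdots\to n\to 1$: the monoid generated by $x_1,\ldots,x_n$ with relations $x_i^2=x_i$; $x_ix_j=x_jx_i$ if $i,j$ are not connected by an arrow; and $x_ix_jx_i=x_jx_ix_j=x_ix_j$ if there is an arrow $i\to j$. For $i=0,\ldots,n-2$ put $s_i=x_n(x_1x_2\cdots x_i)(x_{n-1}x_{n-2}\cdots x_{i+1})\in C_n$ (for $i=0$ the first bracket is empty), let $\langle s_i\rangle$ be the cyclic submonoid generated by $s_i$, $S_i=\{s_i^k:k\geqslant 1\}$ (infinite), and $I_i=\{x\in C_n: C_nxC_n\cap\langle s_i\rangle=\emptyset\}$, an ideal of $C_n$ (possibly empty). $M_i$ is the ideal of the Rees quotient $C_n/I_i$ generated by $s_i$, with zero $\theta$ included (if $I_i=\emptyset$, $C_n/I_i$ means $C_n$ with a zero $\theta$ adjoined). Semigroup of matrix type: for a semigroup $S$, sets $A,B$ and a $B\times A$ matrix $P=(p_{ba})$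 with entries in $S^1\cup\{\theta\}$, $\mathcal{M}^0(S,A,B;P)$ consists of $\theta$ and the triples $(s;a,b)$, $s\in S,a\in A,b\in B$, with $(s;a,b)(t;a',b')=(sp_{ba'}t;a,b')$ if $p_{ba'}\neq\theta$ and $\theta$ otherwise. It is known that there are finite subsets $A_i,B_i\subseteq C_n$ containing $1$, with $|A_i|=|B_i|=\binom{n}{i+1}$, and a $B_i\times A_i$ matrix $P_i=(p_{ba})$ with entries in $\langle s_i\rangle\cup\{\theta\}$, such that $(s_i^k;a,b)\mapsto as_i^kb$, $\theta\mapsto\theta$ is an isomorphism of $\mathcal{M}^0(S_i,A_i,B_i;P_i)$ onto $M_i$; here $p_{ba}=s_i^m$ if $s_ibas_i=s_i^{m+2}$ in $C_n/I_i$, and $p_{ba}=\theta$ if $s_ibas_i=\theta$ in $C_n/I_i$. It is also known that $P_i$ (with $\theta$ read as $0$) is invertible as a matrix over the field of rational functions $K(s_i)$. $K_0[M_i]$ is the contracted semigroup algebra (semigroup algebra modulo $K\theta$). For a commutative ring $R$, $\mathcal{M}(R,A,B;P)$ denotes the algebra of all $A\times B$ matrices over $R$ with product $X\cdot Y=XPY$. Writing $(s;a,b)$ as the matrix with single nonzero entry $s$ at position $(a,b)$, $K_0[M_i]$ embeds in $\mathcal{M}(K[s_i,s_i^{-1}],A_i,B_i;P_i)$. For $\lambda\in K^*$, let $\overline{P}_i$ be the matrix over $K$ obtained from $P_i$ by $s_i\mapsto\lambda$, $\theta\mapsto 0$; evaluation at $\lambda$ gives a homomorphism $\mathcal{M}(K[s_i,s_i^{-1}],A_i,B_i;P_i)\to\mathcal{M}(K,A_i,B_i;\overline{P}_i)$.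 A representation $K_0[M_i]\to M_r(K)$ is induced by the representation $s_i\mapsto\lambda$ of the cyclic group generated by $s_i$ if it is the restriction to $K_0[M_i]$ of the composition of this evaluation homomorphism with a surjective homomorphism $\mathcal{M}(K,A_i,B_i;\overline{P}_i)\to M_r(K)$. Irreducible representations into $M_r(K)$ are the surjective homomorphisms; equivalence means conjugation in $M_r(K)$. *)

theory Defs
  imports
    "HOL-Algebra.Group"
    "HOL-Library.Poly_Mapping"
    "HOL-Computational_Algebra.Polynomial"
    "Jordan_Normal_Form.Matrix"
begin

section \<open>The Hecke--Kiselman monoid of the oriented cycle\<close>

definition arrow :: "nat \<Rightarrow> nat \<Rightarrow> nat \<Rightarrow> bool" where
  "arrow n i j \<longleftrightarrow> i \<in> {1..n} \<and> j \<in> {1..n} \<and> (j = i + 1 \<or> i = n \<and> j = 1)"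

inductive hk_rel :: "nat \<Rightarrow> nat list \<Rightarrow> nat list \<Rightarrow> bool" for n where
  idem: "i \<in> {1..n} \<Longrightarrow> hk_rel n [i, i] [i]"
| comm: "i \<in> {1..n} \<Longrightarrow> j \<in> {1..n} \<Longrightarrow> \<not> arrow n i j \<Longrightarrow> \<not> arrow n j i \<Longrightarrow> hk_rel n [i, j] [j, i]"
| arrow1: "arrow n i j \<Longrightarrow> hk_rel n [i, j, i] [i, j]"
| arrow2: "arrow n i j \<Longrightarrow> hk_rel n [j, i, j] [i, j]"

text \<open>The congruence on the free monoid of words over \<open>{1..n}\<close> generated by the relations.\<close>

inductive hk_cong :: "nat \<Rightarrow> nat list \<Rightarrow> nat list \<Rightarrow> bool" for n where
  step: "p \<in> lists {1..n} \<Longrightarrow> q \<in> lists {1..n} \<Longrightarrow> hk_rel n u v \<Longrightarrow> hk_cong n (p @ u @ q) (p @ v @ q)"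
| refl: "u \<in> lists {1..n} \<Longrightarrow> hk_cong n u u"
| sym: "hk_cong n u v \<Longrightarrow> hk_cong n v u"
| trans: "hk_cong n u v \<Longrightarrow> hk_cong n v w \<Longrightarrow> hk_cong n u w"

definition hk_eq :: "nat \<Rightarrow> (nat list \<times> nat list) set" where
  "hk_eq n = {(u, v). hk_cong n u v}"

definition hk_class :: "nat \<Rightarrow> nat list \<Rightarrow> nat list set" where
  "hk_class n u = hk_eq n `` {u}"

definition hk_monoid :: "nat \<Rightarrow> nat list set monoid" where
  "hk_monoid n =
    \<lparr>carrier = lists {1..n} // hk_eq n,
     monoid.mult = (\<lambda>X Y. \<Union>u\<in>X. \<Union>v\<in>Y. hk_class n (u @ v)),
     one = hk_class n []\<rparr>"

lemma hk_cong_lists: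
  assumes "hk_cong n u v"
  shows "u \<in> lists {1..n} \<and> v \<in> lists {1..n}"
proof -
  have *: "u \<in> lists {1..n} \<and> v \<in> lists {1..n}" if "hk_rel n u v" for u v
    using that by cases (auto simp: arrow_def)
  show ?thesis
    using assms by induction (use * in auto)
qed

lemma equiv_hk_eq: "equiv (lists {1..n}) (hk_eq n)"
proof (rule equivI)
  show "hk_eq n \<subseteq> lists {1..n} \<times> lists {1..n}"
    unfolding hk_eq_def by (rule subrelI) (use hk_cong_lists in blast)
  show "refl_on (lists {1..n}) (hk_eq n)"
    by (rule refl_onI) (simp add: hk_eq_def hk_cong.refl)
  show "sym (hk_eq n)"
    by (rule symI) (simp add: hk_eq_def hk_cong.sym)
  show "trans (hk_eq n)"
    by (rule transI) (unfold hk_eq_def mem_Collect_eq prod.case, rule hk_cong.trans)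
qed

lemma hk_cong_append:
  assumes "hk_cong n u u'" "hk_cong n v v'"
  shows "hk_cong n (u @ v) (u' @ v')"
proof -
  have ctx: "hk_cong n (p @ u @ q) (p @ u' @ q)"
    if "hk_cong n u u'" "p \<in> lists {1..n}" "q \<in> lists {1..n}" for p q u u'
    using that
  proof (induction rule: hk_cong.induct)
    case (step p' q' u v)
    then show ?case
      using hk_cong.step[of "p @ p'" n "q' @ q" u v] by simp
  next
    case (refl u)
    then show ?case by (intro hk_cong.refl) auto
  next
    case (sym u v)
    then show ?case by (blast intro: hk_cong.sym)
  next
    case (trans u v w)
    then show ?case by (meson hk_cong.trans)
  qed
  have "hk_cong n (u @ v) (u' @ v)"
    using ctx[of u u' "[]" v] assms hk_cong_lists by auto
  moreover have "hk_cong n (u' @ v) (u' @ v')"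
    using ctx[of v v' u' "[]"] assms hk_cong_lists by auto
  ultimately show ?thesis by (rule hk_cong.trans)
qed

lemma hk_mult_class:
  assumes "u \<in> lists {1..n}" "v \<in> lists {1..n}"
  shows "hk_class n u \<otimes>\<^bsub>hk_monoid n\<^esub> hk_class n v = hk_class n (u @ v)"
proof -
  have cls: "hk_class n (u' @ v') = hk_class n (u @ v)"
    if "u' \<in> hk_class n u" "v' \<in> hk_class n v" for u' v'
  proof -
    have "hk_cong n (u @ v) (u' @ v')"
      using that by (intro hk_cong_append) (simp_all add: hk_class_def hk_eq_def)
    then have "(u @ v, u' @ v') \<in> hk_eq n"
      by (simp add: hk_eq_def)
    then show ?thesis
      unfolding hk_class_def by (rule equiv_class_eq[OF equiv_hk_eq, symmetric])
  qed
  have "u \<in> hk_class n u" "v \<in> hk_class n v"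
    using assms by (simp_all add: hk_class_def hk_eq_def hk_cong.refl)
  then have "(\<Union>u'\<in>hk_class n u. \<Union>v'\<in>hk_class n v. hk_class n (u' @ v')) = hk_class n (u @ v)"
    using cls by blast
  then show ?thesis
    by (simp add: hk_monoid_def)
qed

lemma monoid_hk_monoid: "monoid (hk_monoid n)"
proof -
  have cls: "\<exists>u\<in>lists {1..n}. x = hk_class n u" if "x \<in> carrier (hk_monoid n)" for x
    using that by (auto simp: hk_monoid_def hk_class_def quotient_def)
  have inC: "hk_class n u \<in> carrier (hk_monoid n)" if "u \<in> lists {1..n}" for u
    using that by (auto simp: hk_monoid_def hk_class_def quotient_def)
  have one: "\<one>\<^bsub>hk_monoid n\<^esub> = hk_class n []"
    by (simp add: hk_monoid_def)
  have app: "u @ v \<in> lists {1..n}" if "u \<in> lists {1..n}" "v \<in> lists {1..n}" for u v :: "nat list"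
    using that by auto
  show ?thesis
  proof (rule monoidI)
    fix x y assume "x \<in> carrier (hk_monoid n)" "y \<in> carrier (hk_monoid n)"
    then obtain u v where "u \<in> lists {1..n}" "x = hk_class n u" "v \<in> lists {1..n}" "y = hk_class n v"
      using cls[of x] cls[of y] by blast
    then show "x \<otimes>\<^bsub>hk_monoid n\<^esub> y \<in> carrier (hk_monoid n)"
      by (simp only: hk_mult_class inC app)
  next
    show "\<one>\<^bsub>hk_monoid n\<^esub> \<in> carrier (hk_monoid n)"
      unfolding one by (rule inC) simp
  next
    fix x y z
    assume "x \<in> carrier (hk_monoid n)" "y \<in> carrier (hk_monoid n)" "z \<in> carrier (hk_monoid n)"
    then obtain u v w where "u \<in> lists {1..n}" "x = hk_class n u" "v \<in> lists {1..n}" "y = hk_class n v"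
        "w \<in> lists {1..n}" "z = hk_class n w"
      using cls[of x] cls[of y] cls[of z] by blast
    then show "x \<otimes>\<^bsub>hk_monoid n\<^esub> y \<otimes>\<^bsub>hk_monoid n\<^esub> z = x \<otimes>\<^bsub>hk_monoid n\<^esub> (y \<otimes>\<^bsub>hk_monoid n\<^esub> z)"
      by (simp only: hk_mult_class app append_assoc)
  next
    fix x assume "x \<in> carrier (hk_monoid n)"
    then obtain u where "u \<in> lists {1..n}" "x = hk_class n u"
      using cls[of x] by blast
    then show "\<one>\<^bsub>hk_monoid n\<^esub> \<otimes>\<^bsub>hk_monoid n\<^esub> x = x" "x \<otimes>\<^bsub>hk_monoid n\<^esub> \<one>\<^bsub>hk_monoid n\<^esub> = x"
      unfolding one by (simp_all only: hk_mult_class lists.Nil append_Nil append_Nil2)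
  qed
qed

text \<open>The element \<open>s\<^sub>i = x\<^sub>n (x\<^sub>1 \<dots> x\<^sub>i) (x\<^bsub>n-1\<^esub> \<dots> x\<^bsub>i+1\<^esub>)\<close>.\<close>

definition hk_s :: "nat \<Rightarrow> nat \<Rightarrow> nat list set" where
  "hk_s n i = hk_class n ([n] @ [1..<i+1] @ rev [i+1..<n])"

definition hk_cyc :: "nat \<Rightarrow> nat \<Rightarrow> nat list set set" where
  "hk_cyc n i = {hk_s n i [^]\<^bsub>hk_monoid n\<^esub> k | k :: nat. True}"

definition hk_S :: "nat \<Rightarrow> nat \<Rightarrow> nat list set set" where
  "hk_S n i = {hk_s n i [^]\<^bsub>hk_monoid n\<^esub> k | k :: nat. k \<ge> 1}"

text \<open>The exponent of a power of \<open>s\<^sub>i\<close>; the powers of \<open>s\<^sub>i\<close> are pairwise distinct, so it is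
  determined by the power.\<close>

definition hk_exp :: "nat \<Rightarrow> nat \<Rightarrow> nat list set \<Rightarrow> nat" where
  "hk_exp n i x = (THE m. x = hk_s n i [^]\<^bsub>hk_monoid n\<^esub> m)"


section \<open>Rees quotients and semigroups of matrix type\<close>

text \<open>In an \<open>option\<close> type the zero \<open>\<theta>\<close> is \<^const>\<open>None\<close>.  The Rees quotient \<open>G/I\<close> consists of
  \<open>\<theta>\<close> and the elements of \<open>G\<close> outside \<open>I\<close>; for \<open>I = {}\<close> this is \<open>G\<close> with a zero adjoined.\<close>

definition rees_proj :: "'c set \<Rightarrow> 'c \<Rightarrow> 'c option" where
  "rees_proj I x = (if x \<in> I then None else Some x)"

definition rees_quotient :: "'c monoid \<Rightarrow> 'c set \<Rightarrow> 'c option monoid" where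
  "rees_quotient G I =
    \<lparr>carrier = insert None (Some ` (carrier G - I)),
     monoid.mult = (\<lambda>x y. case (x, y) of (Some u, Some v) \<Rightarrow> rees_proj I (u \<otimes>\<^bsub>G\<^esub> v) | _ \<Rightarrow> None),
     one = rees_proj I \<one>\<^bsub>G\<^esub>\<rparr>"

definition principal_ideal :: "'c monoid \<Rightarrow> 'c \<Rightarrow> 'c set" where
  "principal_ideal G x = {u \<otimes>\<^bsub>G\<^esub> x \<otimes>\<^bsub>G\<^esub> v | u v. u \<in> carrier G \<and> v \<in> carrier G}"

definition hk_I :: "nat \<Rightarrow> nat \<Rightarrow> nat list set set" where
  "hk_I n i = {x \<in> carrier (hk_monoid n). principal_ideal (hk_monoid n) x \<inter> hk_cyc n i = {}}"

abbreviation hk_quotient :: "nat \<Rightarrow> nat \<Rightarrow> nat list set option monoid" where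
  "hk_quotient n i \<equiv> rees_quotient (hk_monoid n) (hk_I n i)"

definition hk_M :: "nat \<Rightarrow> nat \<Rightarrow> nat list set option set" where
  "hk_M n i = insert None (principal_ideal (hk_quotient n i) (rees_proj (hk_I n i) (hk_s n i)))"

text \<open>The semigroup of matrix type over a subsemigroup \<open>S\<close> of a monoid \<open>G\<close>; the sandwich matrix
  has entries in \<open>S \<union> {1, \<theta>}\<close>, where \<open>1\<close> is the identity of \<open>G\<close>.\<close>

definition matrix_type_carrier :: "'c set \<Rightarrow> 'a set \<Rightarrow> 'b set \<Rightarrow> ('c \<times> 'a \<times> 'b) option set" where
  "matrix_type_carrier S A B = insert None (Some ` (S \<times> A \<times> B))"

definition matrix_type_mult ::
  "'c monoid \<Rightarrow> ('b \<Rightarrow> 'a \<Rightarrow> 'c option) \<Rightarrow>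
    ('c \<times> 'a \<times> 'b) option \<Rightarrow> ('c \<times> 'a \<times> 'b) option \<Rightarrow> ('c \<times> 'a \<times> 'b) option" where
  "matrix_type_mult G P x y =
    (case (x, y) of
       (Some (s, a, b), Some (t, a', b')) \<Rightarrow>
         (case P b a' of Some p \<Rightarrow> Some (s \<otimes>\<^bsub>G\<^esub> p \<otimes>\<^bsub>G\<^esub> t, a, b') | None \<Rightarrow> None)
     | _ \<Rightarrow> None)"

text \<open>The map \<open>(s; a, b) \<mapsto> asb\<close>, \<open>\<theta> \<mapsto> \<theta>\<close> into \<open>C\<^sub>n/I\<^sub>i\<close>.\<close>

definition hk_triple ::
  "nat \<Rightarrow> nat \<Rightarrow> (nat list set \<times> nat list set \<times> nat list set) option \<Rightarrow> nat list set option" where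
  "hk_triple n i x =
    (case x of
       Some (s, a, b) \<Rightarrow> rees_proj (hk_I n i) (a \<otimes>\<^bsub>hk_monoid n\<^esub> s \<otimes>\<^bsub>hk_monoid n\<^esub> b)
     | None \<Rightarrow> None)"

definition hk_matrix_type ::
  "nat \<Rightarrow> nat \<Rightarrow> nat list set set \<Rightarrow> nat list set set \<Rightarrow>
    (nat list set \<Rightarrow> nat list set \<Rightarrow> nat list set option) \<Rightarrow> bool" where
  "hk_matrix_type n i A B P \<longleftrightarrow>
    A \<subseteq> carrier (hk_monoid n) \<and> B \<subseteq> carrier (hk_monoid n) \<and>
    finite A \<and> finite B \<and>
    \<one>\<^bsub>hk_monoid n\<^esub> \<in> A \<and> \<one>\<^bsub>hk_monoid n\<^esub> \<in> B \<and>
    card A = n choose (i + 1) \<and> card B = n choose (i + 1) \<and>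
    (\<forall>b\<in>B. \<forall>a\<in>A.
      case P b a of
        Some p \<Rightarrow> \<exists>m :: nat. p = hk_s n i [^]\<^bsub>hk_monoid n\<^esub> m \<and>
          rees_proj (hk_I n i) (hk_s n i \<otimes>\<^bsub>hk_monoid n\<^esub> b \<otimes>\<^bsub>hk_monoid n\<^esub> a \<otimes>\<^bsub>hk_monoid n\<^esub> hk_s n i)
            = rees_proj (hk_I n i) (hk_s n i [^]\<^bsub>hk_monoid n\<^esub> (m + 2))
      | None \<Rightarrow>
          rees_proj (hk_I n i) (hk_s n i \<otimes>\<^bsub>hk_monoid n\<^esub> b \<otimes>\<^bsub>hk_monoid n\<^esub> a \<otimes>\<^bsub>hk_monoid n\<^esub> hk_s n i)
            = None) \<and>
    bij_betw (hk_triple n i) (matrix_type_carrier (hk_S n i) A B) (hk_M n i) \<and>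
    (\<forall>x\<in>matrix_type_carrier (hk_S n i) A B. \<forall>y\<in>matrix_type_carrier (hk_S n i) A B.
      hk_triple n i (matrix_type_mult (hk_monoid n) P x y)
        = hk_triple n i x \<otimes>\<^bsub>hk_quotient n i\<^esub> hk_triple n i y)"


section \<open>Algebras\<close>

text \<open>The contracted algebra \<open>K\<^sub>0[M] = K[M]/K\<theta>\<close> of a semigroup \<open>M\<close> with zero \<open>\<theta>\<close>: every coset of
  \<open>K\<theta>\<close> has exactly one representative whose coefficient at \<open>\<theta>\<close> is \<open>0\<close>.\<close>

definition contracted_algebra :: "'m set \<Rightarrow> 'm \<Rightarrow> ('m \<Rightarrow> 'k::field) set" where
  "contracted_algebra M \<theta> = {f. finite {x. f x \<noteq> 0} \<and> (\<forall>x. x \<notin> M - {\<theta>} \<longrightarrow> f x = 0)}"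

definition contracted_mult ::
  "('m \<Rightarrow> 'm \<Rightarrow> 'm) \<Rightarrow> 'm \<Rightarrow> ('m \<Rightarrow> 'k::field) \<Rightarrow> ('m \<Rightarrow> 'k) \<Rightarrow> 'm \<Rightarrow> 'k" where
  "contracted_mult mul \<theta> f g z =
    (if z = \<theta> then 0
     else \<Sum>x | f x \<noteq> 0. \<Sum>y | g y \<noteq> 0. if mul x y = z then f x * g y else 0)"

text \<open>The algebra \<open>\<M>(R, A, B; P)\<close> of \<open>A \<times> B\<close> matrices over \<open>R\<close> with product \<open>X P Y\<close>; a matrix is
  a function on pairs that vanishes outside \<open>A \<times> B\<close>.\<close>

definition munn_algebra :: "'a set \<Rightarrow> 'b set \<Rightarrow> ('a \<times> 'b \<Rightarrow> 'r::comm_ring_1) set" where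
  "munn_algebra A B = {X. \<forall>e. e \<notin> A \<times> B \<longrightarrow> X e = 0}"

definition munn_mult ::
  "'a set \<Rightarrow> 'b set \<Rightarrow> ('b \<Rightarrow> 'a \<Rightarrow> 'r::comm_ring_1) \<Rightarrow>
    ('a \<times> 'b \<Rightarrow> 'r) \<Rightarrow> ('a \<times> 'b \<Rightarrow> 'r) \<Rightarrow> 'a \<times> 'b \<Rightarrow> 'r" where
  "munn_mult A B P X Y = (\<lambda>(a, b). \<Sum>b'\<in>B. \<Sum>a'\<in>A. X (a, b') * P b' a' * Y (a', b))"

text \<open>A surjective homomorphism onto \<open>M\<^sub>r(K)\<close> from the \<open>K\<close>-algebra with underlying vector space
  \<open>V\<close> (functions with pointwise operations) and product \<open>mul\<close>.\<close>

definition surj_alg_hom ::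
  "('x \<Rightarrow> 'k::field) set \<Rightarrow> (('x \<Rightarrow> 'k) \<Rightarrow> ('x \<Rightarrow> 'k) \<Rightarrow> 'x \<Rightarrow> 'k) \<Rightarrow> nat \<Rightarrow>
    (('x \<Rightarrow> 'k) \<Rightarrow> 'k mat) \<Rightarrow> bool" where
  "surj_alg_hom V mul r h \<longleftrightarrow>
    h ` V = carrier_mat r r \<and>
    (\<forall>f\<in>V. \<forall>g\<in>V. h (\<lambda>x. f x + g x) = h f + h g) \<and>
    (\<forall>c. \<forall>f\<in>V. h (\<lambda>x. c * f x) = c \<cdot>\<^sub>m h f) \<and>
    (\<forall>f\<in>V. \<forall>g\<in>V. h (mul f g) = h f * h g)"

text \<open>The Laurent polynomial ring \<open>K[s, s\<^sup>-\<^sup>1]\<close> is the group algebra \<open>int \<Rightarrow>\<^sub>0 K\<close> of the integers,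
  with \<open>s\<^sup>k = Poly_Mapping.single k 1\<close>.\<close>

definition laurent_eval :: "'k::field \<Rightarrow> (int \<Rightarrow>\<^sub>0 'k) \<Rightarrow> 'k" where
  "laurent_eval l p = (\<Sum>k\<in>Poly_Mapping.keys p. Poly_Mapping.lookup p k * l powi k)"

definition munn_eval ::
  "'k::field \<Rightarrow> ('a \<times> 'b \<Rightarrow> (int \<Rightarrow>\<^sub>0 'k)) \<Rightarrow> 'a \<times> 'b \<Rightarrow> 'k" where
  "munn_eval l X = (\<lambda>e. laurent_eval l (X e))"

definition laurent_sandwich ::
  "nat \<Rightarrow> nat \<Rightarrow> (nat list set \<Rightarrow> nat list set \<Rightarrow> nat list set option) \<Rightarrow>
    nat list set \<Rightarrow> nat list set \<Rightarrow> (int \<Rightarrow>\<^sub>0 'k::field)" where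
  "laurent_sandwich n i P b a =
    (case P b a of Some p \<Rightarrow> Poly_Mapping.single (int (hk_exp n i p)) 1 | None \<Rightarrow> 0)"

definition eval_sandwich ::
  "nat \<Rightarrow> nat \<Rightarrow> (nat list set \<Rightarrow> nat list set \<Rightarrow> nat list set option) \<Rightarrow> 'k::field \<Rightarrow>
    nat list set \<Rightarrow> nat list set \<Rightarrow> 'k" where
  "eval_sandwich n i P l b a = laurent_eval l (laurent_sandwich n i P b a)"

abbreviation hk_algebra :: "nat \<Rightarrow> nat \<Rightarrow> (nat list set option \<Rightarrow> 'k::field) set" where
  "hk_algebra n i \<equiv> contracted_algebra (hk_M n i) None"

abbreviation hk_algebra_mult ::
  "nat \<Rightarrow> nat \<Rightarrow> (nat list set option \<Rightarrow> 'k::field) \<Rightarrow> (nat list set option \<Rightarrow> 'k) \<Rightarrow>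
    nat list set option \<Rightarrow> 'k" where
  "hk_algebra_mult n i \<equiv> contracted_mult (monoid.mult (hk_quotient n i)) None"

text \<open>The embedding of \<open>K\<^sub>0[M\<^sub>i]\<close> into \<open>\<M>(K[s\<^sub>i, s\<^sub>i\<^sup>-\<^sup>1], A\<^sub>i, B\<^sub>i; P\<^sub>i)\<close>: the basis element
  \<open>a s\<^sub>i\<^sup>k b\<close> goes to the matrix with single nonzero entry \<open>s\<^sub>i\<^sup>k\<close> at position \<open>(a, b)\<close>.\<close>

definition hk_embed ::
  "nat \<Rightarrow> nat \<Rightarrow> nat list set set \<Rightarrow> nat list set set \<Rightarrow> (nat list set option \<Rightarrow> 'k::field) \<Rightarrow>
    nat list set \<times> nat list set \<Rightarrow> (int \<Rightarrow>\<^sub>0 'k)" where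
  "hk_embed n i A B f = (\<lambda>(a, b).
    if a \<in> A \<and> b \<in> B then
      \<Sum>s | s \<in> hk_S n i \<and> f (hk_triple n i (Some (s, a, b))) \<noteq> 0.
        Poly_Mapping.single (int (hk_exp n i s)) (f (hk_triple n i (Some (s, a, b))))
    else 0)"

definition irreducible_rep ::
  "nat \<Rightarrow> nat \<Rightarrow> nat \<Rightarrow> ((nat list set option \<Rightarrow> 'k::field) \<Rightarrow> 'k mat) \<Rightarrow> bool" where
  "irreducible_rep n i r \<psi> \<longleftrightarrow> surj_alg_hom (hk_algebra n i) (hk_algebra_mult n i) r \<psi>"

definition induced_rep ::
  "nat \<Rightarrow> nat \<Rightarrow> nat list set set \<Rightarrow> nat list set set \<Rightarrow>
    (nat list set \<Rightarrow> nat list set \<Rightarrow> nat list set option) \<Rightarrow> 'k::field \<Rightarrow> nat \<Rightarrow>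
    ((nat list set option \<Rightarrow> 'k) \<Rightarrow> 'k mat) \<Rightarrow> bool" where
  "induced_rep n i A B P l r \<psi> \<longleftrightarrow>
    (\<exists>h. surj_alg_hom (munn_algebra A B) (munn_mult A B (eval_sandwich n i P l)) r h \<and>
      (\<forall>f\<in>hk_algebra n i. \<psi> f = h (munn_eval l (hk_embed n i A B f))))"

text \<open>Representations of different degree are inequivalent.\<close>

definition equivalent_reps ::
  "('x \<Rightarrow> 'k::field) set \<Rightarrow> nat \<Rightarrow> (('x \<Rightarrow> 'k) \<Rightarrow> 'k mat) \<Rightarrow> nat \<Rightarrow> (('x \<Rightarrow> 'k) \<Rightarrow> 'k mat) \<Rightarrow> bool" where
  "equivalent_reps V r \<psi> r' \<psi>' \<longleftrightarrow> r = r' \<and>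
    (\<exists>Q\<in>carrier_mat r r. \<exists>Q'\<in>carrier_mat r r. Q * Q' = 1\<^sub>m r \<and> Q' * Q = 1\<^sub>m r \<and>
      (\<forall>f\<in>V. \<psi>' f = Q * \<psi> f * Q'))"

end

theory Submission
  imports Defs "Jordan_Normal_Form.Determinant"
begin

text \<open>
  Evaluating \<open>s\<^sub>i\<close> at \<open>\<lambda> \<noteq> 0\<close> sends the basis element \<open>a s\<^sub>i\<^sup>k b\<close> of \<open>K\<^sub>0[M\<^sub>i]\<close> to \<open>\<lambda>\<^sup>k\<close> times the
  matrix unit at \<open>(a, b)\<close>.  This is a homomorphism into the Munn algebra \<open>\<M>(K, A, B; Q)\<close>, where \<open>Q\<close> is
  the evaluated sandwich matrix, and it is onto because \<open>\<lambda>\<close> is invertible.  The induced representations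
  are therefore exactly the surjections of the Munn algebra onto matrix algebras, pulled back along a
  surjection, and everything reduces to showing that a Munn algebra with nonzero sandwich matrix has,
  up to conjugation, just one surjection onto a matrix algebra of positive degree.

  Existence: if \<open>Q = C D\<close> is a factorisation through \<open>K\<^sup>r\<close> with \<open>r\<close> the rank of \<open>Q\<close>, then
  \<open>X \<mapsto> D X C\<close> is multiplicative, since \<open>D (X Q Y) C = (D X C) (D Y C)\<close>, and it is onto \<open>M\<^sub>r(K)\<close> because
  \<open>D\<close> has a right inverse and \<open>C\<close> a left inverse (\<open>munn_algebra_surj_hom\<close>).

  Uniqueness: if \<open>D X C = 0\<close>, then \<open>Q X Q = 0\<close>, so every product \<open>Y X Z\<close> in the Munn algebra vanishes.  A
  surjection \<open>h\<close> onto a matrix algebra takes the value \<open>1\<close> at some \<open>Y\<close>, whence \<open>h X = h (Y X Y) = 0\<close>.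
  So \<open>h\<close> factors through \<open>X \<mapsto> D X C\<close>, and the induced surjection between matrix algebras is a
  conjugation by the Skolem--Noether theorem (\<open>surj_matrix_algebra_hom_is_conjugation\<close>).

  Two facts about \<open>C\<^sub>n\<close> itself enter.  The powers of \<open>s\<^sub>i\<close> are distinct, so that exponents are well
  defined and additive; this is read off from an action of \<open>C\<^sub>n\<close> on integer sequences
  (\<open>hk_s_power_inj\<close>).  And \<open>Q\<close> is nonzero, because its entry at \<open>(1, 1)\<close> is a power of \<open>\<lambda>\<close>: the
  element \<open>s\<^sub>i\<^sup>2\<close> survives in \<open>C\<^sub>n/I\<^sub>i\<close>.
\<close>

section \<open>The powers of \<open>s\<^sub>i\<close> are distinct\<close>

text \<open>The generator \<open>x\<^sub>j\<close> acts on a state \<open>v\<^sub>1, \<dots>, v\<^sub>n\<close> of integers by copying the value of its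
  successor, and the value copied across the end of the cycle is raised by one.  A word acts from right
  to left, hence as a \<^const>\<open>foldr\<close>.  Without the increment the action would factor through
  finitely many maps; with it, going around the cycle leaves a trace.\<close>

definition cyc_act :: "nat \<Rightarrow> nat \<Rightarrow> (nat \<Rightarrow> int) \<Rightarrow> nat \<Rightarrow> int" where
  "cyc_act n j v = v(j := if j = n then v 1 + 1 else v (Suc j))"

lemma hk_rel_cyc_act:
  assumes "n \<ge> 3" "hk_rel n u v"
  shows "foldr (cyc_act n) u = foldr (cyc_act n) v"
  using assms(2)
proof cases
  case (idem i)
  then show ?thesis using assms(1) by (auto simp: cyc_act_def fun_eq_iff)
next
  case (comm i j)
  then show ?thesis using assms(1) by (auto simp: cyc_act_def fun_eq_iff arrow_def)
next
  case (arrow1 i j)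
  then show ?thesis using assms(1) by (auto simp: cyc_act_def fun_eq_iff arrow_def)
next
  case (arrow2 i j)
  then show ?thesis using assms(1) by (auto simp: cyc_act_def fun_eq_iff arrow_def)
qed

lemma hk_cong_cyc_act:
  assumes "n \<ge> 3" "hk_cong n u v"
  shows "foldr (cyc_act n) u = foldr (cyc_act n) v"
  using assms(2)
proof induction
  case (step p q u v)
  then show ?case using hk_rel_cyc_act[OF assms(1)] by simp
qed auto

text \<open>Letters act from the right, so a descending run starts with its smallest letter and every
  coordinate copies the old value of its successor, whereas an ascending run starts with its largest
  letter and carries the single value \<open>v\<^sub>b\<close> all the way down.\<close>

lemma cyc_act_descending:
  assumes "b \<le> n"
  shows "foldr (cyc_act n) (rev [a..<b]) v = (\<lambda>j. if a \<le> j \<and> j < b then v (Suc j) else v j)"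
  using assms
proof (induction b)
  case (Suc b)
  then show ?case by (auto simp: cyc_act_def fun_eq_iff less_Suc_eq)
qed simp

lemma cyc_act_ascending:
  assumes "b \<le> n"
  shows "foldr (cyc_act n) [a..<b] v = (\<lambda>j. if a \<le> j \<and> j < b then v b else v j)"
  using assms
proof (induction b arbitrary: v)
  case (Suc b)
  then show ?case by (auto simp: cyc_act_def fun_eq_iff less_Suc_eq)
qed simp

abbreviation s_word :: "nat \<Rightarrow> nat \<Rightarrow> nat list" where
  "s_word n i \<equiv> [n] @ [1..<i+1] @ rev [i+1..<n]"

text \<open>The word \<open>s\<^sub>i\<close> rotates the coordinates \<open>i + 2, \<dots>, n\<close> by one place, and the one that moves
  from position \<open>i + 2\<close> to position \<open>n\<close> passes through \<open>v\<^sub>1\<close> and is incremented.  The sum of these coordinates thus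
  counts the factors of a power of \<open>s\<^sub>i\<close>.\<close>

lemma s_word_sum:
  assumes "n \<ge> 3" "i \<le> n - 2"
  shows "(\<Sum>j=i+2..n. foldr (cyc_act n) (s_word n i) v j) = (\<Sum>j=i+2..n. v j) + 1"
proof -
  have m: "i + 2 \<le> n"
    using assms by arith
  define w where "w = foldr (cyc_act n) (s_word n i) v"
  have wn: "w n = v (i + 2) + 1"
    using assms m by (simp add: w_def cyc_act_descending cyc_act_ascending cyc_act_def del: upt_Suc)
  have wj: "w j = v (Suc j)" if "j \<in> {i+2..<n}" for j
    using assms that by (simp add: w_def cyc_act_descending cyc_act_ascending cyc_act_def del: upt_Suc)
  have "(\<Sum>j=i+2..n. w j) = w n + (\<Sum>j\<in>{i+2..<n}. w j)"
    using m by (simp add: sum.last_plus)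
  also have "(\<Sum>j\<in>{i+2..<n}. w j) = (\<Sum>j\<in>{i+2..<n}. v (Suc j))"
    using wj by (intro sum.cong) auto
  also have "\<dots> = (\<Sum>j\<in>{Suc (i+2)..n}. v j)"
    by (rule sum.reindex_bij_witness[of _ "\<lambda>j. j - 1" Suc]) auto
  also have "w n + \<dots> = (\<Sum>j=i+2..n. v j) + 1"
    using m wn sum.atLeast_Suc_atMost[of "i + 2" n v] by simp
  finally show ?thesis by (simp only: w_def)
qed

lemma s_word_power_sum:
  assumes "n \<ge> 3" "i \<le> n - 2"
  shows "(\<Sum>j=i+2..n. foldr (cyc_act n) (concat (replicate k (s_word n i))) v j)
           = (\<Sum>j=i+2..n. v j) + int k"
proof (induction k)
  case (Suc k)
  have "foldr (cyc_act n) (concat (replicate (Suc k) (s_word n i))) v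
     = foldr (cyc_act n) (s_word n i) (foldr (cyc_act n) (concat (replicate k (s_word n i))) v)"
    by (simp del: upt_Suc)
  then show ?case using Suc s_word_sum[OF assms] by (simp del: upt_Suc replicate_Suc)
qed simp

lemma s_word_lists: "n \<ge> 3 \<Longrightarrow> i \<le> n - 2 \<Longrightarrow> s_word n i \<in> lists {1..n}"
  unfolding in_lists_conv_set by auto

lemma hk_class_closed: "u \<in> lists {1..n} \<Longrightarrow> hk_class n u \<in> carrier (hk_monoid n)"
  by (auto simp: hk_monoid_def hk_class_def quotient_def)

lemma hk_s_closed:
  "n \<ge> 3 \<Longrightarrow> i \<le> n - 2 \<Longrightarrow> hk_s n i \<in> carrier (hk_monoid n)"
  unfolding hk_s_def by (rule hk_class_closed, rule s_word_lists)

lemma hk_s_power: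
  assumes "n \<ge> 3" "i \<le> n - 2"
  shows "hk_s n i [^]\<^bsub>hk_monoid n\<^esub> (k::nat) = hk_class n (concat (replicate k (s_word n i)))"
proof (induction k)
  case 0
  then show ?case by (simp add: hk_monoid_def)
next
  case (Suc k)
  interpret monoid "hk_monoid n" by (rule monoid_hk_monoid)
  have *: "concat (replicate k (s_word n i)) \<in> lists {1..n}"
    using s_word_lists[OF assms] by (induction k) (auto simp del: upt_Suc)
  have "hk_s n i [^]\<^bsub>hk_monoid n\<^esub> (Suc k) 
     = hk_s n i \<otimes>\<^bsub>hk_monoid n\<^esub> hk_s n i [^]\<^bsub>hk_monoid n\<^esub> k"
    using nat_pow_Suc2 hk_s_closed[OF assms] by blast
  also have "\<dots> = hk_class n (s_word n i @ concat (replicate k (s_word n i)))"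
    unfolding Suc unfolding hk_s_def by (rule hk_mult_class) (use s_word_lists[OF assms] * in auto)
  finally show ?case by (simp del: upt_Suc)
qed

lemma hk_s_power_inj:
  assumes "n \<ge> 3" "i \<le> n - 2"
    and eq: "hk_s n i [^]\<^bsub>hk_monoid n\<^esub> (k::nat) = hk_s n i [^]\<^bsub>hk_monoid n\<^esub> (m::nat)"
  shows "k = m"
proof -
  let ?c = "\<lambda>k. concat (replicate k (s_word n i))"
  have l: "?c k \<in> lists {1..n}" for k
    using s_word_lists[OF assms(1,2)] by (induction k) (auto simp del: upt_Suc)
  have "hk_class n (?c k) = hk_class n (?c m)"
    using eq by (simp only: hk_s_power[OF assms(1,2)])
  then have "hk_cong n (?c k) (?c m)"
    using l[of k] l[of m] hk_cong.refl unfolding hk_class_def hk_eq_def by blast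
  then have "foldr (cyc_act n) (?c k) (\<lambda>_. 0) = foldr (cyc_act n) (?c m) (\<lambda>_. 0)"
    by (simp only: hk_cong_cyc_act[OF assms(1)])
  then show ?thesis
    using s_word_power_sum[OF assms(1,2), of k "\<lambda>_. 0"] s_word_power_sum[OF assms(1,2), of m "\<lambda>_. 0"]
    by (simp del: upt_Suc)
qed

lemma hk_exp_power:
  assumes "n \<ge> 3" "i \<le> n - 2"
  shows "hk_exp n i (hk_s n i [^]\<^bsub>hk_monoid n\<^esub> m) = m"
  unfolding hk_exp_def
  by (rule the_equality) (use hk_s_power_inj[OF assms] in auto)

section \<open>Surjections onto matrix algebras\<close>

lemma mat_linear_expand:
  fixes f :: "'k::field mat \<Rightarrow> 'k"
  assumes add: "\<And>X Y. X \<in> carrier_mat p q \<Longrightarrow> Y \<in> carrier_mat p q \<Longrightarrow> f (X + Y) = f X + f Y"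
    and smult: "\<And>c X. X \<in> carrier_mat p q \<Longrightarrow> f (c \<cdot>\<^sub>m X) = c * f X"
    and X: "X \<in> carrier_mat p q"
  shows "f X = (\<Sum>(j, k)\<in>{..<p} \<times> {..<q}. X $$ (j, k) * f (mat p q (\<lambda>e. if e = (j, k) then 1 else 0)))"
proof -
  have zero: "f (0\<^sub>m p q) = 0"
    using smult[of "0\<^sub>m p q" 0] by (simp add: smult_zero_mat)
  have "f (mat p q (\<lambda>e. if e \<in> S then X $$ e else 0))
          = (\<Sum>(j, k)\<in>S. X $$ (j, k) * f (mat p q (\<lambda>e. if e = (j, k) then 1 else 0)))"
    if "finite S" for S
    using that
  proof (induction S)
    case empty
    have "mat p q (\<lambda>e. if e \<in> {} then X $$ e else 0) = 0\<^sub>m p q" by auto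
    then show ?case using zero by simp
  next
    case (insert e S)
    obtain j k where e: "e = (j, k)" by (cases e)
    have "mat p q (\<lambda>x. if x \<in> insert e S then X $$ x else 0)
        = X $$ e \<cdot>\<^sub>m mat p q (\<lambda>x. if x = e then 1 else 0) + mat p q (\<lambda>x. if x \<in> S then X $$ x else 0)"
      using insert.hyps by (intro eq_matI) auto
    also have "f \<dots> = X $$ e * f (mat p q (\<lambda>x. if x = e then 1 else 0)) 
        + f (mat p q (\<lambda>x. if x \<in> S then X $$ x else 0))"
      by (subst add) (auto simp: smult)
    finally show ?case using insert e by simp
  qed
  note this[of "{..<p} \<times> {..<q}"]
  moreover have "mat p q (\<lambda>e. if e \<in> {..<p} \<times> {..<q} then X $$ e else 0) = X"
    using X by (intro eq_matI) auto
  ultimately show ?thesis by simp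
qed

text \<open>If \<open>p < q\<close>, padding both matrices with zeros to size \<open>q\<close> keeps \<open>Y X = 1\<close>, so \<open>X Y = 1\<close> by the
  square case; but the last row of the padded \<open>X\<close> is zero.\<close>

lemma left_inverse_dim_le:
  fixes X Y :: "'k::field mat"
  assumes X: "X \<in> carrier_mat p q" and Y: "Y \<in> carrier_mat q p" and YX: "Y * X = 1\<^sub>m q"
  shows "q \<le> p"
proof (rule ccontr)
  assume "\<not> q \<le> p"
  then have pq: "p < q" by simp
  define X' where "X' = mat q q (\<lambda>(j, k). if j < p then X $$ (j, k) else 0)"
  define Y' where "Y' = mat q q (\<lambda>(j, k). if k < p then Y $$ (j, k) else 0)"
  have XY': "X' \<in> carrier_mat q q" "Y' \<in> carrier_mat q q"
    by (simp_all add: X'_def Y'_def)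
  have "Y' * X' = 1\<^sub>m q"
  proof (rule eq_matI)
    fix j k assume jk: "j < dim_row (1\<^sub>m q :: 'k mat)" "k < dim_col (1\<^sub>m q :: 'k mat)"
    have "(Y' * X') $$ (j, k) = (\<Sum>t\<in>{0..<q}. Y' $$ (j, t) * X' $$ (t, k))"
      using jk XY' by (simp add: scalar_prod_def)
    also have "\<dots> = (\<Sum>t\<in>{0..<q}. if t < p then Y $$ (j, t) * X $$ (t, k) else 0)"
      using jk by (intro sum.cong) (auto simp: X'_def Y'_def)
    also have "\<dots> = (\<Sum>t\<in>{0..<p}. Y $$ (j, t) * X $$ (t, k))"
      using pq by (intro sum.mono_neutral_cong_right) auto
    also have "\<dots> = (Y * X) $$ (j, k)"
      using jk X Y by (simp add: scalar_prod_def)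
    finally show "(Y' * X') $$ (j, k) = 1\<^sub>m q $$ (j, k)" using YX by simp
  qed (auto simp: X'_def Y'_def)
  then have "X' * Y' = 1\<^sub>m q"
    by (rule mat_mult_left_right_inverse[OF XY'(2,1)])
  then have "(X' * Y') $$ (p, p) = 1" using pq by simp
  moreover have "(X' * Y') $$ (p, p) = 0"
    using pq by (simp add: X'_def Y'_def scalar_prod_def)
  ultimately show False by simp
qed

text \<open>The Skolem--Noether theorem for matrix algebras.  As \<open>g\<close> is linear and nonzero, some
  \<open>g (E\<^sub>k\<^sub>p)\<close> has a nonzero entry, say in column \<open>c\<close>.  The matrix \<open>T\<close> whose \<open>j\<close>-th column is column \<open>c\<close> of \<open>g (E\<^sub>j\<^sub>p)\<close> intertwines:
  \<open>g X T = T X\<close>.  On the left the factor \<open>g X\<close> can be any matrix unit of \<open>M\<^sub>r(K)\<close>, on the right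
  \<open>X\<close> can be any matrix unit of \<open>M\<^sub>s(K)\<close>; applied around one nonzero entry of \<open>T\<close>, the former gives
  a right inverse of \<open>T\<close> and the latter a left inverse.\<close>

lemma surj_matrix_algebra_hom_is_conjugation:
  fixes g :: "'k::field mat \<Rightarrow> 'k mat"
  assumes surj: "g ` carrier_mat s s = carrier_mat r r"
    and add: "\<And>X Y. X \<in> carrier_mat s s \<Longrightarrow> Y \<in> carrier_mat s s \<Longrightarrow> g (X + Y) = g X + g Y"
    and smult: "\<And>c X. X \<in> carrier_mat s s \<Longrightarrow> g (c \<cdot>\<^sub>m X) = c \<cdot>\<^sub>m g X"
    and mult: "\<And>X Y. X \<in> carrier_mat s s \<Longrightarrow> Y \<in> carrier_mat s s \<Longrightarrow> g (X * Y) = g X * g Y"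
    and r: "1 \<le> r"
  shows "s = r \<and> (\<exists>Q\<in>carrier_mat r r. \<exists>Q'\<in>carrier_mat r r. Q * Q' = 1\<^sub>m r \<and> Q' * Q = 1\<^sub>m r \<and>
      (\<forall>X\<in>carrier_mat s s. g X = Q * X * Q'))"
proof -
  define E where "E j k = mat s s (\<lambda>e. if e = (j, k) then 1 else 0 :: 'k)" for j k
  have E: "E j k \<in> carrier_mat s s" for j k by (simp add: E_def)
  have gc: "g X \<in> carrier_mat r r" if "X \<in> carrier_mat s s" for X
    using imageI[OF that, of g] surj by simp
  have gE: "g (E j k) \<in> carrier_mat r r" for j k using gc E by blast
  have expand: "g X $$ (a, b) = (\<Sum>(j, k)\<in>{..<s} \<times> {..<s}. X $$ (j, k) * g (E j k) $$ (a, b))"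
    if X: "X \<in> carrier_mat s s" and ab: "a < r" "b < r" for X a b
    unfolding E_def
  proof (rule mat_linear_expand[where f = "\<lambda>X. g X $$ (a, b)", OF _ _ X])
    show "g (X + Y) $$ (a, b) = g X $$ (a, b) + g Y $$ (a, b)"
      if "X \<in> carrier_mat s s" "Y \<in> carrier_mat s s" for X Y
      using add[OF that] gc[OF that(1)] gc[OF that(2)] ab by simp
    show "g (c \<cdot>\<^sub>m X) $$ (a, b) = c * g X $$ (a, b)" if "X \<in> carrier_mat s s" for c X
      using smult[OF that] gc[OF that] ab by simp
  qed
  obtain p k a c where nz: "k < s" "p < s" "a < r" "c < r" "g (E k p) $$ (a, c) \<noteq> 0"
  proof -
    have "1\<^sub>m r \<in> g ` carrier_mat s s" unfolding surj by simp
    then obtain X where X: "X \<in> carrier_mat s s" "g X = 1\<^sub>m r" by (metis imageE)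
    then have "g X $$ (0, 0) = 1" using r by simp
    then have "(\<Sum>(j, k)\<in>{..<s} \<times> {..<s}. X $$ (j, k) * g (E j k) $$ (0, 0)) \<noteq> 0"
      using expand[OF X(1), of 0 0] r by simp
    then obtain e where "e \<in> {..<s} \<times> {..<s}" "(case e of (j, k) \<Rightarrow> X $$ (j, k) * g (E j k) $$ (0, 0)) \<noteq> 0"
      by (rule sum.not_neutral_contains_not_neutral)
    then show thesis using that[of "fst e" "snd e" 0 0] r by auto
  qed
  define T where "T = mat r s (\<lambda>(d, j). g (E j p) $$ (d, c))"
  have T: "T \<in> carrier_mat r s" by (simp add: T_def)
  have Tak: "T $$ (a, k) \<noteq> 0" using nz by (simp add: T_def)
  have inter: "g X * T = T * X" if X: "X \<in> carrier_mat s s" for X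
  proof (rule eq_matI)
    fix d j assume "d < dim_row (T * X)" "j < dim_col (T * X)"
    then have dj: "d < r" "j < s" using T X by auto
    have XE: "(X * E j p) $$ (u, v) = (if v = p then X $$ (u, j) else 0)" if "u < s" "v < s" for u v
    proof -
      have "(X * E j p) $$ (u, v) = (\<Sum>t\<in>{0..<s}. X $$ (u, t) * (if t = j \<and> v = p then 1 else 0))"
        using that X dj by (simp add: scalar_prod_def E_def)
      also have "\<dots> = (\<Sum>t\<in>{0..<s}. if t = j then (if v = p then X $$ (u, j) else 0) else 0)"
        by (intro sum.cong) auto
      finally show ?thesis using dj by simp
    qed
    have "(g X * T) $$ (d, j) = (g X * g (E j p)) $$ (d, c)"
      using dj gc[OF X] gE[of j p] T nz by (auto simp: scalar_prod_def T_def intro!: sum.cong)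
    also have "\<dots> = g (X * E j p) $$ (d, c)" using mult[OF X E] by simp
    also have "\<dots> = (\<Sum>u<s. \<Sum>v<s. (X * E j p) $$ (u, v) * g (E u v) $$ (d, c))"
      using expand[of "X * E j p" d c] X E dj nz by (simp add: sum.cartesian_product)
    also have "\<dots> = (\<Sum>u<s. \<Sum>v<s. if v = p then X $$ (u, j) * g (E u p) $$ (d, c) else 0)"
      using XE by (intro sum.cong) auto
    also have "\<dots> = (\<Sum>u<s. X $$ (u, j) * g (E u p) $$ (d, c))" using nz by simp
    also have "\<dots> = (T * X) $$ (d, j)"
      using dj X by (auto simp: scalar_prod_def T_def mult.commute lessThan_atLeast0 intro!: sum.cong)
    finally show "(g X * T) $$ (d, j) = (T * X) $$ (d, j)" .
  qed (use T X gc[OF X] in auto)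
  have "mat r r (\<lambda>e. if e = (u, a) then 1 else 0) \<in> g ` carrier_mat s s" for u
    unfolding surj by simp
  then have "\<exists>X. X \<in> carrier_mat s s \<and> g X = mat r r (\<lambda>e. if e = (u, a) then 1 else 0)" for u
    by (metis (no_types, lifting) imageE)
  then obtain F where F: "F u \<in> carrier_mat s s" "g (F u) = mat r r (\<lambda>e. if e = (u, a) then 1 else 0)" for u
    by metis
  \<comment> \<open>Here \<open>F\<^sub>u\<close> is a preimage of the matrix unit at \<open>(u, a)\<close>.  Column \<open>k\<close> of \<open>T F\<^sub>u = g (F\<^sub>u) T\<close> is \<open>T\<^sub>a\<^sub>k\<close> times the \<open>u\<close>-th unit vector,
     and row \<open>a\<close> of \<open>g (E\<^sub>k\<^sub>j) T = T E\<^sub>k\<^sub>j\<close> is \<open>T\<^sub>a\<^sub>k\<close> times the \<open>j\<close>-th unit vector.\<close>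
  define R where "R = mat s r (\<lambda>(j, u). F u $$ (j, k) / T $$ (a, k))"
  define L where "L = mat s r (\<lambda>(j, u). g (E k j) $$ (a, u) / T $$ (a, k))"
  have RL: "R \<in> carrier_mat s r" "L \<in> carrier_mat s r" by (simp_all add: R_def L_def)
  have TR: "T * R = 1\<^sub>m r"
  proof (rule eq_matI)
    fix d u assume "d < dim_row (1\<^sub>m r :: 'k mat)" "u < dim_col (1\<^sub>m r :: 'k mat)"
    then have du: "d < r" "u < r" by auto
    have "(T * R) $$ (d, u) = (T * F u) $$ (d, k) / T $$ (a, k)"
      using du T F(1)[of u] nz by (auto simp: scalar_prod_def R_def sum_divide_distrib intro!: sum.cong)
    also have "T * F u = g (F u) * T" using inter F(1) by simp
    also have "(g (F u) * T) $$ (d, k) = (\<Sum>t\<in>{0..<r}. (if (d, t) = (u, a) then 1 else 0) * T $$ (t, k))"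
      using du T nz by (simp add: scalar_prod_def F(2))
    also have "\<dots> = (\<Sum>t\<in>{0..<r}. if t = a then (if d = u then T $$ (a, k) else 0) else 0)"
      by (intro sum.cong) auto
    also have "\<dots> = (if d = u then T $$ (a, k) else 0)" using nz by simp
    finally show "(T * R) $$ (d, u) = 1\<^sub>m r $$ (d, u)" using du Tak by auto
  qed (use T RL in auto)
  have LT: "L * T = 1\<^sub>m s"
  proof (rule eq_matI)
    fix j v assume "j < dim_row (1\<^sub>m s :: 'k mat)" "v < dim_col (1\<^sub>m s :: 'k mat)"
    then have jv: "j < s" "v < s" by auto
    have "(L * T) $$ (j, v) = (g (E k j) * T) $$ (a, v) / T $$ (a, k)"
      using jv T gE[of k j] nz by (auto simp: scalar_prod_def L_def sum_divide_distrib intro!: sum.cong)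
    also have "g (E k j) * T = T * E k j" using inter E by simp
    also have "(T * E k j) $$ (a, v) = (\<Sum>t\<in>{0..<s}. T $$ (a, t) * (if (t, v) = (k, j) then 1 else 0))"
      using jv T nz by (simp add: scalar_prod_def E_def)
    also have "\<dots> = (\<Sum>t\<in>{0..<s}. if t = k then (if v = j then T $$ (a, k) else 0) else 0)"
      by (intro sum.cong) auto
    also have "\<dots> = (if v = j then T $$ (a, k) else 0)" using nz by simp
    finally show "(L * T) $$ (j, v) = 1\<^sub>m s $$ (j, v)" using jv Tak by auto
  qed (use T RL in auto)
  have sr: "s = r"
    using left_inverse_dim_le[OF T RL(2) LT] left_inverse_dim_le[OF RL(1) T TR] by simp
  have TL: "T * L = 1\<^sub>m r"
    using mat_mult_left_right_inverse[of L r T] RL T LT sr by simp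
  have conj: "g X = T * X * L" if X: "X \<in> carrier_mat s s" for X
  proof -
    have "T * X * L = g X * T * L" using inter[OF X] by simp
    also have "\<dots> = g X * (T * L)"
      using gc[OF X] T RL by (intro assoc_mult_mat) auto
    also have "\<dots> = g X" using TL gc[OF X] by simp
    finally show ?thesis by simp
  qed
  have "\<forall>X\<in>carrier_mat s s. g X = T * X * L" using conj by blast
  then show ?thesis
    using sr T RL TL LT by (intro conjI bexI[of _ T] bexI[of _ L]) auto
qed

text \<open>By the kernel inclusion \<open>h\<close> factors as \<open>g \<circ> h0\<close> with a surjective \<open>g\<close> between matrix
  algebras, which is a conjugation.\<close>

lemma surj_alg_hom_equivalent_if_kernel_le:
  fixes V :: "('x \<Rightarrow> 'k::field) set"
  assumes h0: "surj_alg_hom V mul s h0" and h: "surj_alg_hom V mul r h" and r: "1 \<le> r"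
    and closed: "\<And>f g. f \<in> V \<Longrightarrow> g \<in> V \<Longrightarrow> (\<lambda>x. f x + g x) \<in> V" "\<And>c f. f \<in> V \<Longrightarrow> (\<lambda>x. c * f x) \<in> V"
      "\<And>f g. f \<in> V \<Longrightarrow> g \<in> V \<Longrightarrow> mul f g \<in> V"
    and kernel: "\<And>f. f \<in> V \<Longrightarrow> h0 f = 0\<^sub>m s s \<Longrightarrow> h f = 0\<^sub>m r r"
  shows "equivalent_reps V s h0 r h"
proof -
  have im0: "h0 ` V = carrier_mat s s" and im: "h ` V = carrier_mat r r"
    using h0 h by (auto simp: surj_alg_hom_def)
  have add0: "h0 (\<lambda>x. f x + f' x) = h0 f + h0 f'" and add: "h (\<lambda>x. f x + f' x) = h f + h f'"
    and mul0: "h0 (mul f f') = h0 f * h0 f'" and mul: "h (mul f f') = h f * h f'"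
    if "f \<in> V" "f' \<in> V" for f f'
    using h0 h that by (auto simp: surj_alg_hom_def)
  have smult0: "h0 (\<lambda>x. a * f x) = a \<cdot>\<^sub>m h0 f" and smult: "h (\<lambda>x. a * f x) = a \<cdot>\<^sub>m h f"
    if "f \<in> V" for a f
    using h0 h that by (auto simp: surj_alg_hom_def)
  have c0: "h0 f \<in> carrier_mat s s" and c: "h f \<in> carrier_mat r r" if "f \<in> V" for f
    using imageI[OF that, of h0] imageI[OF that, of h] im0 im by simp_all
  have wd: "h f = h f'" if f: "f \<in> V" "f' \<in> V" and eq: "h0 f = h0 f'" for f f'
  proof -
    let ?m = "\<lambda>x. - 1 * f' x" and ?e = "\<lambda>x. f x + (- 1 * f' x)"
    have m: "?m \<in> V" by (rule closed(2)[OF f(2)])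
    have e: "?e \<in> V" by (rule closed(1)[OF f(1) m])
    have "h0 ?e = h0 f + (- 1) \<cdot>\<^sub>m h0 f'" by (simp only: add0[OF f(1) m] smult0[OF f(2)])
    then have "h0 ?e = 0\<^sub>m s s" using eq c0[OF f(2)] by auto
    then have "h ?e = 0\<^sub>m r r" by (rule kernel[OF e])
    moreover have "h ?e = h f + (- 1) \<cdot>\<^sub>m h f'" by (simp only: add[OF f(1) m] smult[OF f(2)])
    ultimately have z: "h f + (- 1) \<cdot>\<^sub>m h f' = 0\<^sub>m r r" by simp
    show ?thesis
    proof (rule eq_matI)
      fix j k assume "j < dim_row (h f')" "k < dim_col (h f')"
      then show "h f $$ (j, k) = h f' $$ (j, k)"
        using arg_cong[OF z, of "\<lambda>M. M $$ (j, k)"] c[OF f(1)] c[OF f(2)] by simp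
    qed (use c[OF f(1)] c[OF f(2)] in auto)
  qed
  define g where "g Y = h (SOME f. f \<in> V \<and> h0 f = Y)" for Y
  have gh: "g (h0 f) = h f" if "f \<in> V" for f
  proof -
    have "(SOME f'. f' \<in> V \<and> h0 f' = h0 f) \<in> V \<and> h0 (SOME f'. f' \<in> V \<and> h0 f' = h0 f) = h0 f"
      by (rule someI[of _ f]) (use that in simp)
    then show ?thesis unfolding g_def using wd that by blast
  qed
  have pre: "\<exists>f\<in>V. Y = h0 f" if "Y \<in> carrier_mat s s" for Y
    using that unfolding im0[symmetric] by auto
  have "s = r \<and> (\<exists>Q\<in>carrier_mat r r. \<exists>Q'\<in>carrier_mat r r. Q * Q' = 1\<^sub>m r \<and> Q' * Q = 1\<^sub>m r \<and>
      (\<forall>X\<in>carrier_mat s s. g X = Q * X * Q'))"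
  proof (rule surj_matrix_algebra_hom_is_conjugation[OF _ _ _ _ r])
    have "g ` carrier_mat s s = g ` h0 ` V" by (simp only: im0)
    also have "\<dots> = h ` V" using gh by (auto simp: image_image)
    finally show "g ` carrier_mat s s = carrier_mat r r" by (simp only: im)
  next
    fix X Y :: "'k mat" assume "X \<in> carrier_mat s s" "Y \<in> carrier_mat s s"
    then obtain f f' where *: "f \<in> V" "X = h0 f" "f' \<in> V" "Y = h0 f'" using pre by metis
    show "g (X + Y) = g X + g Y"
      using gh[OF closed(1)[OF *(1,3)]] by (simp only: * add0 add gh)
    show "g (X * Y) = g X * g Y"
      using gh[OF closed(3)[OF *(1,3)]] by (simp only: * mul0 mul gh)
  next
    fix a and X :: "'k mat" assume "X \<in> carrier_mat s s"
    then obtain f where *: "f \<in> V" "X = h0 f" using pre by metis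
    show "g (a \<cdot>\<^sub>m X) = a \<cdot>\<^sub>m g X"
      using gh[OF closed(2)[OF *(1), of a]] by (simp only: * smult0 smult gh)
  qed
  then obtain Q Q' where sr: "s = r" and Q: "Q \<in> carrier_mat r r" "Q' \<in> carrier_mat r r"
      "Q * Q' = 1\<^sub>m r \<and> Q' * Q = 1\<^sub>m r" and g: "\<forall>X\<in>carrier_mat s s. g X = Q * X * Q'"
    by blast
  have "h f = Q * h0 f * Q'" if "f \<in> V" for f
    using bspec[OF g c0[OF that]] gh[OF that] by simp
  then have "\<forall>f\<in>V. h f = Q * h0 f * Q'" by blast
  then show ?thesis
    unfolding equivalent_reps_def using sr Q by (intro conjI bexI[of _ Q] bexI[of _ Q']) auto
qed

section \<open>The Munn algebra over a field\<close>

text \<open>One step of elimination: subtracting from \<open>Q\<close> the rank one matrix through a nonzero entry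
  \<open>Q b0 a0\<close> leaves a matrix \<open>R\<close> that vanishes in row \<open>b0\<close> and column \<open>a0\<close>, so the induction runs
  on the columns other than \<open>a0\<close>.  The right inverse \<open>d'\<close> shows that the columns \<open>c k\<close> of the
  factorisation of \<open>R\<close> vanish at \<open>b0\<close> along with \<open>R\<close>, and then one correction term in each of the
  one-sided inverses restores biorthogonality.\<close>

lemma rank_factorisation:
  fixes Q :: "'b \<Rightarrow> 'a \<Rightarrow> 'k::field"
  assumes "finite A" "finite B"
  shows "\<exists>r \<le> card A. \<exists>c d c' d'.
    (\<forall>b\<in>B. \<forall>a\<in>A. Q b a = (\<Sum>k<r. c k b * d k a)) \<and>
    (\<forall>j<r. \<forall>k<r. (\<Sum>a\<in>A. d j a * d' k a) = (if j = k then 1 else 0)) \<and>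
    (\<forall>j<r. \<forall>k<r. (\<Sum>b\<in>B. c' j b * c k b) = (if j = k then 1 else 0))"
  using assms(1)
proof (induction A arbitrary: Q rule: finite_psubset_induct)
  case (psubset A)
  show ?case
  proof (cases "\<forall>b\<in>B. \<forall>a\<in>A. Q b a = 0")
    case True
    then show ?thesis by (intro exI[of _ "0::nat"]) simp
  next
    case False
    then obtain b0 a0 where *: "b0 \<in> B" "a0 \<in> A" "Q b0 a0 \<noteq> 0" by blast
    let ?q = "Q b0 a0" and ?A = "A - {a0}"
    define R where "R b a = Q b a - Q b a0 * Q b0 a / ?q" for b a
    have A: "A = insert a0 ?A" "finite ?A" "a0 \<notin> ?A" using * psubset.hyps by auto
    have "?A \<subset> A" using * by blast
    from psubset.IH[OF this, of R] obtain r c d c' d' where r: "r \<le> card ?A"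
      and R: "\<And>b a. b \<in> B \<Longrightarrow> a \<in> ?A \<Longrightarrow> R b a = (\<Sum>k<r. c k b * d k a)"
      and dd: "\<And>j k. j < r \<Longrightarrow> k < r \<Longrightarrow> (\<Sum>a\<in>?A. d j a * d' k a) = (if j = k then 1 else 0)"
      and cc: "\<And>j k. j < r \<Longrightarrow> k < r \<Longrightarrow> (\<Sum>b\<in>B. c' j b * c k b) = (if j = k then 1 else 0)"
      by blast
    have c0: "c k b0 = 0" if k: "k < r" for k
    proof -
      have "0 = (\<Sum>a\<in>?A. R b0 a * d' k a)" using * by (simp add: R_def)
      also have "\<dots> = (\<Sum>a\<in>?A. \<Sum>j<r. c j b0 * (d j a * d' k a))"
        using R * by (intro sum.cong) (auto simp: sum_distrib_right mult.assoc)
      also have "\<dots> = (\<Sum>j<r. c j b0 * (\<Sum>a\<in>?A. d j a * d' k a))"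
        by (subst sum.swap) (simp add: sum_distrib_left)
      also have "\<dots> = (\<Sum>j<r. if j = k then c k b0 else 0)"
        using dd k by (intro sum.cong) auto
      finally show ?thesis using k by simp
    qed
    \<comment> \<open>Index \<open>r\<close> is the new rank one term; \<open>C'\<close> and \<open>D'\<close> are corrected to be orthogonal to it.\<close>
    define C where "C k b = (if k = r then Q b a0 / ?q else c k b)" for k b
    define D where "D k a = (if k = r then Q b0 a else if a = a0 then 0 else d k a)" for k a
    define D' where "D' k a = (if k = r then (if a = a0 then 1 / ?q else 0)
        else if a = a0 then - (\<Sum>a\<in>?A. Q b0 a * d' k a) / ?q else d' k a)" for k a
    define C' where "C' k b = (if k = r then (if b = b0 then 1 else 0)
        else c' k b - (if b = b0 then \<Sum>b\<in>B. c' k b * (Q b a0 / ?q) else 0))" for k b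
    have sumA: "(\<Sum>a\<in>A. f a) = f a0 + (\<Sum>a\<in>?A. f a)" for f :: "'a \<Rightarrow> 'k"
      using A by (metis sum.insert)
    have "Suc r \<le> card A" using A r by (metis card_insert_disjoint Suc_le_mono)
    moreover have "Q b a = (\<Sum>k<Suc r. C k b * D k a)" if "b \<in> B" "a \<in> A" for b a
    proof (cases "a = a0")
      case True
      then show ?thesis using * by (simp add: C_def D_def)
    next
      case False
      then have "(\<Sum>k<r. C k b * D k a) = R b a" using R that by (simp add: C_def D_def)
      then show ?thesis by (simp add: C_def D_def R_def)
    qed
    moreover have "(\<Sum>a\<in>A. D j a * D' k a) = (if j = k then 1 else 0)" if "j < Suc r" "k < Suc r" for j k
    proof -
      have e: "(\<Sum>a\<in>?A. D j a * D' k a) = (if k = r then 0 else if j = r then (\<Sum>a\<in>?A. Q b0 a * d' k a)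
          else (\<Sum>a\<in>?A. d j a * d' k a))"
        by (auto simp: D_def D'_def intro!: sum.cong sum.neutral)
      show ?thesis
        unfolding sumA e using that dd[of j k] * by (auto simp: D_def D'_def)
    qed
    moreover have "(\<Sum>b\<in>B. C' j b * C k b) = (if j = k then 1 else 0)" if "j < Suc r" "k < Suc r" for j k
    proof -
      have pick: "(\<Sum>b\<in>B. (if b = b0 then x else 0) * f b) = x * f b0" for x and f :: "'b \<Rightarrow> 'k"
        using * assms(2) by (simp add: if_distrib[of "\<lambda>x. x * _"] cong: if_cong)
      show ?thesis
      proof (cases "j = r")
        case True
        then have "(\<Sum>b\<in>B. C' j b * C k b) = C k b0" using pick[of 1 "C k"] by (simp add: C'_def)
        then show ?thesis using True that * c0[of k] by (auto simp: C_def)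
      next
        case False
        let ?x = "\<Sum>b\<in>B. c' j b * (Q b a0 / ?q)"
        have "(\<Sum>b\<in>B. C' j b * C k b) = (\<Sum>b\<in>B. c' j b * C k b) - ?x * C k b0"
          unfolding pick[symmetric] sum_subtractf[symmetric] using False
          by (intro sum.cong) (auto simp: C'_def algebra_simps)
        then show ?thesis using False that * c0[of k] cc[of j k] by (auto simp: C_def)
      qed
    qed
    ultimately show ?thesis by blast
  qed
qed

lemma munn_algebra_closed:
  fixes P :: "'b \<Rightarrow> 'a \<Rightarrow> 'r::comm_ring_1"
  shows "X \<in> munn_algebra A B \<Longrightarrow> Y \<in> munn_algebra A B \<Longrightarrow> (\<lambda>e. X e + Y e) \<in> munn_algebra A B"
    and "X \<in> munn_algebra A B \<Longrightarrow> (\<lambda>e. x * X e) \<in> munn_algebra A B"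
    and "X \<in> munn_algebra A B \<Longrightarrow> Y \<in> munn_algebra A B \<Longrightarrow> munn_mult A B P X Y \<in> munn_algebra A B"
  by (auto simp: munn_algebra_def munn_mult_def intro!: sum.neutral)

text \<open>The homomorphism is \<open>X \<mapsto> D X C\<close> for the factorisation \<open>Q = C D\<close>, and a preimage of \<open>Y\<close> is
  \<open>D' Y C'\<close>.  The half products \<open>L X = D X\<close> and \<open>M X = X C\<close> turn the Munn product into
  \<open>X \<cdot> Y = M X \<cdot> L Y\<close>, with \<open>L (X \<cdot> Z) = (D X C) \<cdot> L Z\<close>; the latter gives both multiplicativity
  and the vanishing of \<open>Y \<cdot> (X \<cdot> Z)\<close> for \<open>X\<close> in the kernel.\<close>

lemma munn_algebra_surj_hom:
  fixes Q :: "'b \<Rightarrow> 'a \<Rightarrow> 'k::field"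
  assumes fin: "finite A" "finite B"
  shows "\<exists>r h0. r \<le> card A \<and> (r = 0 \<longrightarrow> (\<forall>b\<in>B. \<forall>a\<in>A. Q b a = 0)) \<and>
    surj_alg_hom (munn_algebra A B) (munn_mult A B Q) r h0 \<and>
    (\<forall>X Y Z. h0 X = 0\<^sub>m r r \<longrightarrow> munn_mult A B Q Y (munn_mult A B Q X Z) = (\<lambda>_. 0))"
proof -
  obtain r c d c' d' where r: "r \<le> card A"
    and Q: "\<And>b a. b \<in> B \<Longrightarrow> a \<in> A \<Longrightarrow> Q b a = (\<Sum>k<r. c k b * d k a)"
    and dd: "\<And>j k. j < r \<Longrightarrow> k < r \<Longrightarrow> (\<Sum>a\<in>A. d j a * d' k a) = (if j = k then 1 else 0)"
    and cc: "\<And>j k. j < r \<Longrightarrow> k < r \<Longrightarrow> (\<Sum>b\<in>B. c' j b * c k b) = (if j = k then 1 else 0)"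
    using rank_factorisation[OF fin, of Q] by blast
  define L where "L X j b = (\<Sum>a\<in>A. d j a * X (a, b))" for X :: "'a \<times> 'b \<Rightarrow> 'k" and j b
  define M where "M X a k = (\<Sum>b\<in>B. X (a, b) * c k b)" for X :: "'a \<times> 'b \<Rightarrow> 'k" and a k
  define H where "H X j k = (\<Sum>b\<in>B. L X j b * c k b)" for X j k
  define h0 where "h0 X = mat r r (\<lambda>(j, k). H X j k)" for X
  have H_alt: "H X j k = (\<Sum>a\<in>A. d j a * M X a k)" for X j k
    unfolding H_def L_def M_def
    by (simp add: sum_distrib_left sum_distrib_right mult.assoc) (rule sum.swap)
  have mult: "munn_mult A B Q X Y (a, b) = (\<Sum>k<r. M X a k * L Y k b)" for X Y a b
  proof -
    have "munn_mult A B Q X Y (a, b)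
        = (\<Sum>b'\<in>B. \<Sum>a'\<in>A. \<Sum>k<r. (X (a, b') * c k b') * (d k a' * Y (a', b)))"
      using Q by (auto simp: munn_mult_def sum_distrib_left sum_distrib_right mult.assoc intro!: sum.cong)
    also have "\<dots> = (\<Sum>b'\<in>B. \<Sum>k<r. \<Sum>a'\<in>A. (X (a, b') * c k b') * (d k a' * Y (a', b)))"
      by (intro sum.cong HOL.refl) (rule sum.swap)
    also have "\<dots> = (\<Sum>k<r. \<Sum>b'\<in>B. \<Sum>a'\<in>A. (X (a, b') * c k b') * (d k a' * Y (a', b)))"
      by (rule sum.swap)
    also have "\<dots> = (\<Sum>k<r. M X a k * L Y k b)"
      by (simp add: M_def L_def sum_product)
    finally show ?thesis .
  qed
  have L_mult: "L (munn_mult A B Q X Y) j b = (\<Sum>k<r. H X j k * L Y k b)" for X Y j b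
    unfolding L_def[of "munn_mult A B Q X Y"] mult H_alt
    by (simp add: sum_distrib_left sum_distrib_right mult.assoc) (rule sum.swap)
  have H_mult: "H (munn_mult A B Q X Y) j k = (\<Sum>m<r. H X j m * H Y m k)" for X Y j k
    unfolding H_def[of "munn_mult A B Q X Y"] L_mult H_def[of Y]
    by (simp add: sum_distrib_left sum_distrib_right mult.assoc) (rule sum.swap)
  have "surj_alg_hom (munn_algebra A B) (munn_mult A B Q) r h0"
    unfolding surj_alg_hom_def
  proof (intro conjI ballI allI)
    show "h0 ` munn_algebra A B = carrier_mat r r"
    proof (intro equalityI subsetI)
      fix Y :: "'k mat" assume Y: "Y \<in> carrier_mat r r"
      define X where "X = (\<lambda>(a, b). if a \<in> A \<and> b \<in> B
        then \<Sum>j<r. d' j a * (\<Sum>k<r. Y $$ (j, k) * c' k b) else 0)"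
      have "X \<in> munn_algebra A B" by (auto simp: munn_algebra_def X_def)
      moreover have "h0 X = Y"
      proof (rule eq_matI)
        fix j k assume "j < dim_row Y" "k < dim_col Y"
        then have jk: "j < r" "k < r" using Y by auto
        have L: "L X j b = (\<Sum>k<r. Y $$ (j, k) * c' k b)" if b: "b \<in> B" for b
        proof -
          have "L X j b = (\<Sum>a\<in>A. \<Sum>i<r. (d j a * d' i a) * (\<Sum>k<r. Y $$ (i, k) * c' k b))"
            using b by (auto simp: L_def X_def sum_distrib_left mult.assoc intro!: sum.cong)
          also have "\<dots> = (\<Sum>i<r. (\<Sum>a\<in>A. d j a * d' i a) * (\<Sum>k<r. Y $$ (i, k) * c' k b))"
            by (subst sum.swap) (simp only: sum_distrib_right)
          also have "\<dots> = (\<Sum>i<r. if i = j then (\<Sum>k<r. Y $$ (j, k) * c' k b) else 0)"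
            using dd jk by (intro sum.cong) auto
          finally show ?thesis using jk by simp
        qed
        have "H X j k = (\<Sum>b\<in>B. \<Sum>i<r. Y $$ (j, i) * (c' i b * c k b))"
          unfolding H_def using L by (intro sum.cong) (auto simp: sum_distrib_right mult.assoc)
        also have "\<dots> = (\<Sum>i<r. Y $$ (j, i) * (\<Sum>b\<in>B. c' i b * c k b))"
          by (subst sum.swap) (simp only: sum_distrib_left)
        also have "\<dots> = (\<Sum>i<r. if i = k then Y $$ (j, k) else 0)"
          using cc jk by (intro sum.cong) auto
        finally show "h0 X $$ (j, k) = Y $$ (j, k)" using jk by (simp add: h0_def)
      qed (use Y in \<open>auto simp: h0_def\<close>)
      ultimately show "Y \<in> h0 ` munn_algebra A B" by blast
    qed (auto simp: h0_def)
  next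
    fix X Y
    show "h0 (\<lambda>x. X x + Y x) = h0 X + h0 Y"
      by (intro eq_matI) (auto simp: h0_def H_def L_def algebra_simps sum.distrib)
    show "h0 (munn_mult A B Q X Y) = h0 X * h0 Y"
      by (intro eq_matI) (auto simp: h0_def H_mult scalar_prod_def lessThan_atLeast0)
  next
    fix x X
    show "h0 (\<lambda>e. x * X e) = x \<cdot>\<^sub>m h0 X"
      by (intro eq_matI) (auto simp: h0_def H_def L_def sum_distrib_left sum_distrib_right algebra_simps)
  qed
  moreover have "munn_mult A B Q Y (munn_mult A B Q X Z) = (\<lambda>_. 0)" if z: "h0 X = 0\<^sub>m r r" for X Y Z
  proof -
    have "H X j k = 0" if "j < r" "k < r" for j k
      using arg_cong[OF z, of "\<lambda>W. W $$ (j, k)"] that by (simp add: h0_def)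
    then show ?thesis by (auto simp: fun_eq_iff mult L_mult)
  qed
  moreover have "r = 0 \<longrightarrow> (\<forall>b\<in>B. \<forall>a\<in>A. Q b a = 0)" using Q by simp
  ultimately show ?thesis using r by blast
qed

text \<open>Since a surjection \<open>h\<close> onto a matrix algebra takes the value \<open>1\<close>, it kills every \<open>X\<close> all of whose
  products \<open>Y X Z\<close> vanish; hence the kernel of the map given by the rank factorisation lies in that
  of \<open>h\<close>.\<close>

lemma munn_algebra_unique_surj_hom:
  fixes Q :: "'b \<Rightarrow> 'a \<Rightarrow> 'k::field"
  assumes fin: "finite A" "finite B" and nz: "b \<in> B" "a \<in> A" "Q b a \<noteq> 0"
  obtains r h0 where "1 \<le> r" "r \<le> card A"
    "surj_alg_hom (munn_algebra A B) (munn_mult A B Q) r h0"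
    "\<forall>r' h. surj_alg_hom (munn_algebra A B) (munn_mult A B Q) r' h \<longrightarrow> 1 \<le> r' \<longrightarrow>
       equivalent_reps (munn_algebra A B) r h0 r' h"
proof -
  let ?V = "munn_algebra A B :: ('a \<times> 'b \<Rightarrow> 'k) set" and ?mul = "munn_mult A B Q"
  obtain r h0 where r: "r \<le> card A" "r = 0 \<longrightarrow> (\<forall>b\<in>B. \<forall>a\<in>A. Q b a = 0)"
    and h0: "surj_alg_hom ?V ?mul r h0"
    and kernel: "\<And>X Y Z. h0 X = 0\<^sub>m r r \<Longrightarrow> ?mul Y (?mul X Z) = (\<lambda>_. 0)"
    using munn_algebra_surj_hom[OF fin, of Q] by blast
  have r1: "1 \<le> r" using r(2) nz by fastforce
  have kernel_le: "h X = 0\<^sub>m r' r'"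
    if h: "surj_alg_hom ?V ?mul r' h" and X: "X \<in> ?V" "h0 X = 0\<^sub>m r r" for r' h X
  proof -
    have "1\<^sub>m r' \<in> h ` ?V" using h by (simp add: surj_alg_hom_def)
    then obtain Y where Y: "Y \<in> ?V" "h Y = 1\<^sub>m r'" by (metis imageE)
    have hX: "h X \<in> carrier_mat r' r'" using imageI[OF X(1), of h] h by (simp add: surj_alg_hom_def)
    have hmul: "h (?mul U W) = h U * h W" if "U \<in> ?V" "W \<in> ?V" for U W
      using h that by (simp add: surj_alg_hom_def)
    have "h (?mul Y (?mul X Y)) = h X"
      using hmul[OF Y(1) munn_algebra_closed(3)[OF X(1) Y(1)]] hmul[OF X(1) Y(1)] Y(2) hX by simp
    then have "h X = h (\<lambda>e. 0 * X e)" by (simp add: kernel[OF X(2)])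
    also have "\<dots> = 0 \<cdot>\<^sub>m h X" using h X(1) by (simp only: surj_alg_hom_def)
    also have "\<dots> = 0\<^sub>m r' r'" using hX by (intro eq_matI) auto
    finally show ?thesis .
  qed
  have equiv: "equivalent_reps ?V r h0 r' h" if "surj_alg_hom ?V ?mul r' h" "1 \<le> r'" for r' h
    by (rule surj_alg_hom_equivalent_if_kernel_le[OF h0 that munn_algebra_closed kernel_le[OF that(1)]])
  show thesis using that[OF r1 r(1) h0] equiv by blast
qed

section \<open>Evaluating the contracted algebra at \<open>\<lambda>\<close>\<close>

lemma laurent_eval_add: "laurent_eval l (p + q) = laurent_eval l p + laurent_eval l q"
proof -
  have ext: "laurent_eval l r = (\<Sum>k\<in>Poly_Mapping.keys p \<union> Poly_Mapping.keys q. Poly_Mapping.lookup r k * l powi k)"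
    if "Poly_Mapping.keys r \<subseteq> Poly_Mapping.keys p \<union> Poly_Mapping.keys q" for r :: "int \<Rightarrow>\<^sub>0 'a"
    unfolding laurent_eval_def using that
    by (intro sum.mono_neutral_left) (auto simp: in_keys_iff)
  show ?thesis
    using ext[of p] ext[of q] ext[of "p + q"] Poly_Mapping.keys_add[of p q]
    by (simp add: lookup_add algebra_simps sum.distrib)
qed

lemma laurent_eval_single: "laurent_eval l (Poly_Mapping.single (int m) c) = c * l ^ m"
  by (simp add: laurent_eval_def)

lemma laurent_eval_zero: "laurent_eval l 0 = 0"
  by (simp add: laurent_eval_def)

lemma laurent_eval_sum: "laurent_eval l (\<Sum>x\<in>F. f x) = (\<Sum>x\<in>F. laurent_eval l (f x))"
  by (induction F rule: infinite_finite_induct) (simp_all add: laurent_eval_add laurent_eval_zero)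

lemma eval_sandwich_eq:
  "eval_sandwich n i P l b a = (case P b a of Some p \<Rightarrow> l ^ hk_exp n i p | None \<Rightarrow> 0)"
  by (simp add: eval_sandwich_def laurent_sandwich_def laurent_eval_single laurent_eval_zero split: option.split)

text \<open>The universal property of the contracted algebra in terms of coefficients: a function \<open>w\<close> on the
  semigroup that vanishes at \<open>\<theta>\<close> extends linearly, and the value of the extension at a product is the
  double sum of the values of \<open>w\<close> at products of basis elements.\<close>

lemma contracted_mult_weighted_sum:
  fixes f g w :: "'m \<Rightarrow> 'k::field"
  assumes f: "finite {x. f x \<noteq> 0}" and g: "finite {x. g x \<noteq> 0}" and w: "w \<theta> = 0"
  shows "(\<Sum>z | contracted_mult mul \<theta> f g z \<noteq> 0. contracted_mult mul \<theta> f g z * w z)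
    = (\<Sum>x | f x \<noteq> 0. \<Sum>y | g y \<noteq> 0. f x * g y * w (mul x y))"
    and "{z. contracted_mult mul \<theta> f g z \<noteq> 0} \<subseteq> (\<lambda>(x, y). mul x y) ` ({x. f x \<noteq> 0} \<times> {x. g x \<noteq> 0})"
proof -
  let ?F = "{x. f x \<noteq> 0}" and ?G = "{x. g x \<noteq> 0}"
  let ?Z = "(\<lambda>(x, y). mul x y) ` (?F \<times> ?G)"
  show sub: "{z. contracted_mult mul \<theta> f g z \<noteq> 0} \<subseteq> ?Z"
  proof
    fix z assume "z \<in> {z. contracted_mult mul \<theta> f g z \<noteq> 0}"
    then have "(\<Sum>x\<in>?F. \<Sum>y\<in>?G. if mul x y = z then f x * g y else 0) \<noteq> 0"
      by (simp add: contracted_mult_def split: if_splits)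
    then obtain x where x: "x \<in> ?F" "(\<Sum>y\<in>?G. if mul x y = z then f x * g y else 0) \<noteq> 0"
      by (rule sum.not_neutral_contains_not_neutral)
    from x(2) obtain y where "y \<in> ?G" "(if mul x y = z then f x * g y else 0) \<noteq> 0"
      by (rule sum.not_neutral_contains_not_neutral)
    then show "z \<in> ?Z" using x by (auto split: if_splits)
  qed
  have finZ: "finite ?Z" using f g by simp
  have "(\<Sum>z | contracted_mult mul \<theta> f g z \<noteq> 0. contracted_mult mul \<theta> f g z * w z)
      = (\<Sum>z\<in>?Z. contracted_mult mul \<theta> f g z * w z)"
    using sub finZ by (intro sum.mono_neutral_left) auto
  also have "\<dots> = (\<Sum>z\<in>?Z. \<Sum>x\<in>?F. \<Sum>y\<in>?G. if mul x y = z then f x * g y * w z else 0)"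
  proof (rule sum.cong)
    fix z
    have "(\<Sum>x\<in>?F. \<Sum>y\<in>?G. if mul x y = z then f x * g y else 0) * w z
      = (\<Sum>x\<in>?F. \<Sum>y\<in>?G. if mul x y = z then f x * g y * w z else 0)"
      unfolding sum_distrib_right by (intro sum.cong) auto
    moreover have "(\<Sum>x\<in>?F. \<Sum>y\<in>?G. if mul x y = z then f x * g y * w z else 0) = 0" if "z = \<theta>"
      using w that by (intro sum.neutral ballI) auto
    ultimately show "contracted_mult mul \<theta> f g z * w z
      = (\<Sum>x\<in>?F. \<Sum>y\<in>?G. if mul x y = z then f x * g y * w z else 0)"
      by (simp add: contracted_mult_def)
  qed simp
  also have "\<dots> = (\<Sum>x\<in>?F. \<Sum>z\<in>?Z. \<Sum>y\<in>?G. if mul x y = z then f x * g y * w z else 0)"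
    by (rule sum.swap)
  also have "\<dots> = (\<Sum>x\<in>?F. \<Sum>y\<in>?G. \<Sum>z\<in>?Z. if mul x y = z then f x * g y * w z else 0)"
    by (intro sum.cong HOL.refl sum.swap)
  also have "\<dots> = (\<Sum>x\<in>?F. \<Sum>y\<in>?G. f x * g y * w (mul x y))"
    using finZ by (intro sum.cong) (auto simp: sum.delta)
  finally show "(\<Sum>z | contracted_mult mul \<theta> f g z \<noteq> 0. contracted_mult mul \<theta> f g z * w z)
    = (\<Sum>x\<in>?F. \<Sum>y\<in>?G. f x * g y * w (mul x y))" .
qed

lemma weighted_sum_superset:
  assumes "finite F" "{z. f z \<noteq> 0} \<subseteq> F"
  shows "(\<Sum>z | f z \<noteq> 0. f z * (w z :: 'k::field)) = (\<Sum>z\<in>F. f z * w z)"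
  using assms by (intro sum.mono_neutral_left) auto

lemma surj_alg_hom_compose:
  assumes h: "surj_alg_hom W mul' r h" and E: "E ` V = W"
    and "\<And>f g. f \<in> V \<Longrightarrow> g \<in> V \<Longrightarrow> E (\<lambda>x. f x + g x) = (\<lambda>x. E f x + E g x)"
    and "\<And>c f. f \<in> V \<Longrightarrow> E (\<lambda>x. c * f x) = (\<lambda>x. c * E f x)"
    and "\<And>f g. f \<in> V \<Longrightarrow> g \<in> V \<Longrightarrow> E (mul f g) = mul' (E f) (E g)"
  shows "surj_alg_hom V mul r (\<lambda>f. h (E f))"
proof -
  have "E f \<in> W" if "f \<in> V" for f using imageI[OF that, of E] E by simp
  moreover have "(\<lambda>f. h (E f)) ` V = h ` W" unfolding E[symmetric] by (simp add: image_image)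
  ultimately show ?thesis using assms unfolding surj_alg_hom_def by simp
qed

locale hk_matrix_data =
  fixes n i :: nat and A B :: "nat list set set"
    and P :: "nat list set \<Rightarrow> nat list set \<Rightarrow> nat list set option"
  assumes n: "n \<ge> 3" and i: "i \<le> n - 2" and matrix_type: "hk_matrix_type n i A B P"
begin

abbreviation "G \<equiv> hk_monoid n"
abbreviation "s \<equiv> hk_s n i"
abbreviation "T \<equiv> matrix_type_carrier (hk_S n i) A B"

lemma fin: "finite A" "finite B" using matrix_type by (simp_all add: hk_matrix_type_def)

lemma one_in: "\<one>\<^bsub>G\<^esub> \<in> A" "\<one>\<^bsub>G\<^esub> \<in> B" using matrix_type by (simp_all add: hk_matrix_type_def)

lemma triple_bij: "bij_betw (hk_triple n i) T (hk_M n i)"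
  using matrix_type by (simp add: hk_matrix_type_def)

lemma triple_mult:
  "x \<in> T \<Longrightarrow> y \<in> T \<Longrightarrow> hk_triple n i (matrix_type_mult G P x y)
     = hk_triple n i x \<otimes>\<^bsub>hk_quotient n i\<^esub> hk_triple n i y"
  using matrix_type by (simp add: hk_matrix_type_def)

lemma sandwich_entry:
  assumes "b \<in> B" "a \<in> A"
  shows "case P b a of
      Some p \<Rightarrow> \<exists>m :: nat. p = s [^]\<^bsub>G\<^esub> m \<and>
        rees_proj (hk_I n i) (s \<otimes>\<^bsub>G\<^esub> b \<otimes>\<^bsub>G\<^esub> a \<otimes>\<^bsub>G\<^esub> s) = rees_proj (hk_I n i) (s [^]\<^bsub>G\<^esub> (m + 2))
    | None \<Rightarrow> rees_proj (hk_I n i) (s \<otimes>\<^bsub>G\<^esub> b \<otimes>\<^bsub>G\<^esub> a \<otimes>\<^bsub>G\<^esub> s) = None"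
  using matrix_type assms unfolding hk_matrix_type_def by blast

lemma sandwich_power:
  assumes "b \<in> B" "a \<in> A" "P b a = Some p"
  obtains m :: nat where "p = s [^]\<^bsub>G\<^esub> m"
  using sandwich_entry[OF assms(1,2)] assms(3) that by auto

text \<open>If the entry were \<open>\<theta>\<close>, then \<open>s\<^sub>i\<^sup>2\<close> would lie in \<open>I\<^sub>i\<close>, although the ideal that it
  generates contains a power of \<open>s\<^sub>i\<close>, namely \<open>s\<^sub>i\<^sup>2\<close> itself.\<close>

lemma sandwich_one_one: "P \<one>\<^bsub>G\<^esub> \<one>\<^bsub>G\<^esub> \<noteq> None"
proof
  assume None: "P \<one>\<^bsub>G\<^esub> \<one>\<^bsub>G\<^esub> = None"
  interpret monoid G by (rule monoid_hk_monoid)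
  have s: "s \<in> carrier G" using hk_s_closed[OF n i] .
  have "rees_proj (hk_I n i) (s \<otimes>\<^bsub>G\<^esub> s) = None"
    using sandwich_entry[OF one_in(2,1)] None s by simp
  then have "s \<otimes>\<^bsub>G\<^esub> s \<in> hk_I n i" by (simp add: rees_proj_def split: if_splits)
  then have "principal_ideal G (s \<otimes>\<^bsub>G\<^esub> s) \<inter> hk_cyc n i = {}" by (simp add: hk_I_def)
  moreover have "s \<otimes>\<^bsub>G\<^esub> s = \<one>\<^bsub>G\<^esub> \<otimes>\<^bsub>G\<^esub> (s \<otimes>\<^bsub>G\<^esub> s) \<otimes>\<^bsub>G\<^esub> \<one>\<^bsub>G\<^esub>" using s by simp
  then have "s \<otimes>\<^bsub>G\<^esub> s \<in> principal_ideal G (s \<otimes>\<^bsub>G\<^esub> s)"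
    unfolding principal_ideal_def using one_closed by blast
  moreover have "s \<otimes>\<^bsub>G\<^esub> s = s [^]\<^bsub>G\<^esub> (2::nat)" using s by (simp add: numeral_2_eq_2)
  then have "s \<otimes>\<^bsub>G\<^esub> s \<in> hk_cyc n i" unfolding hk_cyc_def by blast
  ultimately show False by blast
qed

lemma power_mult: "s [^]\<^bsub>G\<^esub> (k::nat) \<otimes>\<^bsub>G\<^esub> s [^]\<^bsub>G\<^esub> (m::nat) = s [^]\<^bsub>G\<^esub> (k + m)"
  by (rule monoid.nat_pow_mult[OF monoid_hk_monoid hk_s_closed[OF n i]])

lemma exp_power: "hk_exp n i (s [^]\<^bsub>G\<^esub> m) = m"
  by (rule hk_exp_power[OF n i])

lemma in_S_cases:
  assumes "x \<in> hk_S n i" obtains k :: nat where "x = s [^]\<^bsub>G\<^esub> k" "k \<ge> 1"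
  using assms unfolding hk_S_def by blast

text \<open>Additivity of exponents rests on the powers of \<open>s\<^sub>i\<close> being distinct; it is what makes
  evaluation at \<open>\<lambda>\<close> multiplicative.\<close>

lemma sandwich_mult:
  assumes "x \<in> hk_S n i" "y \<in> hk_S n i" "b \<in> B" "a \<in> A" "P b a = Some p"
  shows "x \<otimes>\<^bsub>G\<^esub> p \<otimes>\<^bsub>G\<^esub> y \<in> hk_S n i"
    and "hk_exp n i (x \<otimes>\<^bsub>G\<^esub> p \<otimes>\<^bsub>G\<^esub> y) = hk_exp n i x + hk_exp n i p + hk_exp n i y"
proof -
  obtain k :: nat where k: "x = s [^]\<^bsub>G\<^esub> k" "k \<ge> 1" by (rule in_S_cases[OF assms(1)])
  obtain m :: nat where m: "y = s [^]\<^bsub>G\<^esub> m" "m \<ge> 1" by (rule in_S_cases[OF assms(2)])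
  obtain j :: nat where j: "p = s [^]\<^bsub>G\<^esub> j" by (rule sandwich_power[OF assms(3-5)])
  note * = k m j
  have **: "x \<otimes>\<^bsub>G\<^esub> p \<otimes>\<^bsub>G\<^esub> y = s [^]\<^bsub>G\<^esub> (k + j + m)"
    unfolding * power_mult ..
  have "k + j + m \<ge> 1" using * by simp
  then show "x \<otimes>\<^bsub>G\<^esub> p \<otimes>\<^bsub>G\<^esub> y \<in> hk_S n i" unfolding ** hk_S_def by blast
  show "hk_exp n i (x \<otimes>\<^bsub>G\<^esub> p \<otimes>\<^bsub>G\<^esub> y) = hk_exp n i x + hk_exp n i p + hk_exp n i y"
    unfolding ** unfolding * exp_power ..
qed

lemma mult_closed: "x \<in> T \<Longrightarrow> y \<in> T \<Longrightarrow> matrix_type_mult G P x y \<in> T"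
  using sandwich_mult(1) by (auto simp: matrix_type_carrier_def matrix_type_mult_def split: option.split)

definition decode where "decode = the_inv_into T (hk_triple n i)"

lemma decode_triple: "x \<in> T \<Longrightarrow> decode (hk_triple n i x) = x"
  unfolding decode_def using triple_bij by (intro the_inv_into_f_f) (auto simp: bij_betw_def)

lemma triple_in_M: "x \<in> T \<Longrightarrow> hk_triple n i x \<in> hk_M n i"
  using triple_bij by (auto simp: bij_betw_def)

lemma M_cases: assumes "z \<in> hk_M n i" obtains x where "x \<in> T" "z = hk_triple n i x"
  using triple_bij assms unfolding bij_betw_def by (metis imageE)

lemma triple_None: "None \<in> T" "hk_triple n i None = None"
  by (simp_all add: matrix_type_carrier_def hk_triple_def)

text \<open>The image of a basis element \<open>a s\<^sub>i\<^sup>k b\<close> in the Munn algebra over \<open>K\<close>: the entry \<open>\<lambda>\<^sup>k\<close> at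
  \<open>(a, b)\<close>.  The evaluated embedding is the linear extension of this map
  (\<open>specialise_weighted_sum\<close>), so its multiplicativity needs checking only on basis elements.\<close>

definition weight :: "'k::field \<Rightarrow> nat list set option \<Rightarrow> nat list set \<times> nat list set \<Rightarrow> 'k" where
  "weight l z e = (case decode z of Some (x, a, b) \<Rightarrow> if e = (a, b) then l ^ hk_exp n i x else 0 | None \<Rightarrow> 0)"

lemma weight_triple:
  assumes "x \<in> hk_S n i" "a \<in> A" "b \<in> B"
  shows "weight l (hk_triple n i (Some (x, a, b))) e = (if e = (a, b) then l ^ hk_exp n i x else 0)"
proof -
  have "Some (x, a, b) \<in> T" using assms by (simp add: matrix_type_carrier_def)
  then show ?thesis by (simp add: weight_def decode_triple)
qed

lemma weight_None: "weight l None e = 0"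
  using decode_triple[OF triple_None(1)] by (simp add: weight_def triple_None)

lemma weight_mult:
  assumes "y \<in> hk_M n i" "z \<in> hk_M n i"
  shows "weight l (y \<otimes>\<^bsub>hk_quotient n i\<^esub> z) = munn_mult A B (eval_sandwich n i P l) (weight l y) (weight l z)"
proof -
  obtain u v where u: "u \<in> T" "y = hk_triple n i u" and v: "v \<in> T" "z = hk_triple n i v"
    by (metis M_cases[OF assms(1)] M_cases[OF assms(2)])
  have yz: "y \<otimes>\<^bsub>hk_quotient n i\<^esub> z = hk_triple n i (matrix_type_mult G P u v)"
    using triple_mult u v by simp
  show ?thesis
  proof (cases "u = None \<or> v = None")
    case True
    then have "matrix_type_mult G P u v = None" by (auto simp: matrix_type_mult_def split: option.split)
    then have "y \<otimes>\<^bsub>hk_quotient n i\<^esub> z = None" by (simp only: yz triple_None)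
    moreover have "y = None \<or> z = None" using True u v triple_None by auto
    ultimately show ?thesis
      by (auto simp only: weight_None munn_mult_def fun_eq_iff split_paired_All prod.case mult_zero_left mult_zero_right sum.neutral_const)
  next
    case False
    then obtain x a b x' a' b' where *: "u = Some (x, a, b)" "v = Some (x', a', b')"
      "x \<in> hk_S n i" "a \<in> A" "b \<in> B" "x' \<in> hk_S n i" "a' \<in> A" "b' \<in> B"
      using u(1) v(1) by (auto simp: matrix_type_carrier_def)
    have wu: "weight l y e = (if e = (a, b) then l ^ hk_exp n i x else 0)"
      and wv: "weight l z e = (if e = (a', b') then l ^ hk_exp n i x' else 0)" for e
      using * by (simp_all add: u v weight_triple)
    have rhs: "munn_mult A B Q (weight l y) (weight l z) (a1, b1) =
      (if (a1, b1) = (a, b') then l ^ hk_exp n i x * Q b a' * l ^ hk_exp n i x' else 0)" for Q a1 b1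
    proof -
      have "munn_mult A B Q (weight l y) (weight l z) (a1, b1) = (\<Sum>b2\<in>B. \<Sum>a2\<in>A.
        if a2 = a' then (if b2 = b \<and> (a1, b1) = (a, b') then l ^ hk_exp n i x * Q b a' * l ^ hk_exp n i x' else 0) else 0)"
        unfolding munn_mult_def wu wv by (auto intro!: sum.cong)
      also have "\<dots> = (\<Sum>b2\<in>B. if b2 = b then (if (a1, b1) = (a, b') then l ^ hk_exp n i x * Q b a' * l ^ hk_exp n i x' else 0) else 0)"
        using fin * by (intro sum.cong) (auto simp: sum.delta)
      also have "\<dots> = (if (a1, b1) = (a, b') then l ^ hk_exp n i x * Q b a' * l ^ hk_exp n i x' else 0)"
        using fin * by (simp add: sum.delta)
      finally show ?thesis .
    qed
    show ?thesis
    proof (cases "P b a'")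
      case None
      then have "matrix_type_mult G P u v = None" using * by (simp add: matrix_type_mult_def)
      then show ?thesis
        using None by (auto simp: fun_eq_iff yz triple_None weight_None rhs eval_sandwich_eq)
    next
      case (Some p)
      then have "matrix_type_mult G P u v = Some (x \<otimes>\<^bsub>G\<^esub> p \<otimes>\<^bsub>G\<^esub> x', a, b')"
        using * by (simp add: matrix_type_mult_def)
      then show ?thesis
        using Some * sandwich_mult[OF *(3,6,5,7) Some]
        by (auto simp: fun_eq_iff yz weight_triple rhs eval_sandwich_eq power_add)
    qed
  qed
qed

abbreviation specialise :: "'k::field \<Rightarrow> (nat list set option \<Rightarrow> 'k) \<Rightarrow> nat list set \<times> nat list set \<Rightarrow> 'k" where
  "specialise l f \<equiv> munn_eval l (hk_embed n i A B f)"

lemma specialise_pointwise: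
  "specialise l f (a, b) = (if a \<in> A \<and> b \<in> B then
     \<Sum>x | x \<in> hk_S n i \<and> f (hk_triple n i (Some (x, a, b))) \<noteq> 0.
       f (hk_triple n i (Some (x, a, b))) * l ^ hk_exp n i x else 0)"
  by (simp add: munn_eval_def hk_embed_def laurent_eval_zero laurent_eval_sum laurent_eval_single)

lemma specialise_weighted_sum:
  assumes f: "f \<in> hk_algebra n i"
  shows "specialise l f e = (\<Sum>z | f z \<noteq> 0. f z * weight l z e)"
proof -
  obtain a b where e: "e = (a, b)" by (cases e)
  have fin: "finite {z. f z \<noteq> 0}" and supp0: "\<And>z. z \<notin> hk_M n i - {None} \<Longrightarrow> f z = 0"
    using f unfolding contracted_algebra_def by blast+
  have supp: "z \<in> hk_M n i \<and> z \<noteq> None" if "f z \<noteq> 0" for z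
  proof (rule ccontr)
    assume "\<not> ?thesis"
    then have "z \<notin> hk_M n i - {None}" by blast
    then show False using supp0 that by simp
  qed
  have supp': "\<exists>x a b. x \<in> hk_S n i \<and> a \<in> A \<and> b \<in> B \<and> z = hk_triple n i (Some (x, a, b))"
    if nz: "f z \<noteq> 0" for z
  proof -
    obtain u where u: "u \<in> T" "z = hk_triple n i u" by (rule M_cases[OF conjunct1[OF supp[OF nz]]])
    have "u \<noteq> None"
    proof
      assume "u = None"
      then have "z = None" using u(2) triple_None(2) by simp
      then show False using supp[OF nz] by simp
    qed
    then show ?thesis using u(1) unfolding u(2) matrix_type_carrier_def by auto
  qed
  show ?thesis
  proof (cases "a \<in> A \<and> b \<in> B")
    case False
    then have "weight l z e = 0" if "f z \<noteq> 0" for z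
      using supp'[OF that] e by (auto simp: weight_triple)
    then show ?thesis using False by (auto simp: e specialise_pointwise intro!: sum.neutral)
  next
    case True
    let ?t = "\<lambda>x. hk_triple n i (Some (x, a, b))"
    let ?X = "{x. x \<in> hk_S n i \<and> f (?t x) \<noteq> 0}"
    have inj: "inj_on ?t ?X"
    proof (rule inj_onI)
      fix x y assume "x \<in> ?X" "y \<in> ?X" and eq: "?t x = ?t y"
      then have "Some (x, a, b) \<in> T" "Some (y, a, b) \<in> T" using True by (auto simp: matrix_type_carrier_def)
      then show "x = y" using decode_triple eq by (metis option.inject prod.inject)
    qed
    have "(\<Sum>z | f z \<noteq> 0. f z * weight l z e) = (\<Sum>z\<in>?t ` ?X. f z * weight l z e)"
    proof (intro sum.mono_neutral_right fin ballI)
      fix z assume z: "z \<in> {z. f z \<noteq> 0} - ?t ` ?X"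
      then obtain x a' b' where *: "x \<in> hk_S n i" "a' \<in> A" "b' \<in> B" "z = hk_triple n i (Some (x, a', b'))"
        using supp'[of z] by auto
      then have "(a', b') \<noteq> (a, b)" using z by auto
      then show "f z * weight l z e = 0" using * e by (auto simp: weight_triple)
    qed auto
    also have "\<dots> = (\<Sum>x\<in>?X. f (?t x) * weight l (?t x) e)"
      using inj by (simp add: sum.reindex)
    also have "\<dots> = (\<Sum>x\<in>?X. f (?t x) * l ^ hk_exp n i x)"
      using True by (intro sum.cong) (auto simp: weight_triple e)
    finally show ?thesis using True by (simp add: e specialise_pointwise)
  qed
qed

lemma algebra_closed:
  fixes f g :: "nat list set option \<Rightarrow> 'k::field"
  assumes f: "f \<in> hk_algebra n i" and g: "g \<in> hk_algebra n i"
  shows "(\<lambda>x. f x + g x) \<in> hk_algebra n i" and "(\<lambda>x. c * f x) \<in> hk_algebra n i"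
    and "hk_algebra_mult n i f g \<in> hk_algebra n i"
proof -
  have F: "finite {x. f x \<noteq> 0}" "finite {x. g x \<noteq> 0}" "\<And>x. x \<notin> hk_M n i - {None} \<Longrightarrow> f x = 0"
    "\<And>x. x \<notin> hk_M n i - {None} \<Longrightarrow> g x = 0"
    using f g unfolding contracted_algebra_def by blast+
  show "(\<lambda>x. f x + g x) \<in> hk_algebra n i"
    using F by (auto simp: contracted_algebra_def intro: finite_subset[of _ "{x. f x \<noteq> 0} \<union> {x. g x \<noteq> 0}"])
  show "(\<lambda>x. c * f x) \<in> hk_algebra n i"
    using F by (auto simp: contracted_algebra_def intro: finite_subset[of _ "{x. f x \<noteq> 0}"])
  let ?m = "hk_algebra_mult n i f g"
  let ?Z = "(\<lambda>(x, y). x \<otimes>\<^bsub>hk_quotient n i\<^esub> y) ` ({x. f x \<noteq> 0} \<times> {x. g x \<noteq> 0})"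
  have sub: "{z. ?m z \<noteq> 0} \<subseteq> ?Z"
    by (rule contracted_mult_weighted_sum(2)[OF F(1,2), of "\<lambda>_. 0"]) simp
  have "finite {z. ?m z \<noteq> 0}" using F by (intro finite_subset[OF sub]) simp
  moreover have "?m z = 0" if "z \<notin> hk_M n i - {None}" for z
  proof (cases "z = None")
    case False
    show ?thesis
    proof (rule ccontr)
      assume "?m z \<noteq> 0"
      then obtain x y where xy: "f x \<noteq> 0" "g y \<noteq> 0" "z = x \<otimes>\<^bsub>hk_quotient n i\<^esub> y" using sub by auto
      then have M: "x \<in> hk_M n i" "y \<in> hk_M n i" using F(3)[of x] F(4)[of y] by auto
      obtain u where u: "u \<in> T" "x = hk_triple n i u" by (rule M_cases[OF M(1)])
      obtain v where v: "v \<in> T" "y = hk_triple n i v" by (rule M_cases[OF M(2)])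
      have "z = hk_triple n i (matrix_type_mult G P u v)"
        unfolding xy(3) u(2) v(2) triple_mult[OF u(1) v(1)] ..
      then have "z \<in> hk_M n i" using triple_in_M[OF mult_closed[OF u(1) v(1)]] by simp
      then show False using False that by simp
    qed
  qed (simp add: contracted_mult_def)
  ultimately show "?m \<in> hk_algebra n i" by (simp add: contracted_algebra_def)
qed

lemma specialise_add:
  assumes f: "f \<in> hk_algebra n i" and g: "g \<in> hk_algebra n i"
  shows "specialise l (\<lambda>x. f x + g x) = (\<lambda>e. specialise l f e + specialise l g e)"
proof
  fix e :: "nat list set \<times> nat list set"
  let ?F = "{x. f x \<noteq> 0} \<union> {x. g x \<noteq> 0}"
  have F: "finite ?F" using f g by (auto simp: contracted_algebra_def)
  have "specialise l (\<lambda>x. f x + g x) e = (\<Sum>z\<in>?F. (f z + g z) * weight l z e)"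
    unfolding specialise_weighted_sum[OF algebra_closed(1)[OF f g]]
    by (rule weighted_sum_superset[OF F]) auto
  also have "\<dots> = (\<Sum>z\<in>?F. f z * weight l z e) + (\<Sum>z\<in>?F. g z * weight l z e)"
    by (simp only: distrib_right sum.distrib)
  also have "(\<Sum>z\<in>?F. f z * weight l z e) = specialise l f e"
    unfolding specialise_weighted_sum[OF f] by (rule weighted_sum_superset[OF F, symmetric]) auto
  also have "(\<Sum>z\<in>?F. g z * weight l z e) = specialise l g e"
    unfolding specialise_weighted_sum[OF g] by (rule weighted_sum_superset[OF F, symmetric]) auto
  finally show "specialise l (\<lambda>x. f x + g x) e = specialise l f e + specialise l g e" .
qed

lemma specialise_smult:
  assumes f: "f \<in> hk_algebra n i"
  shows "specialise l (\<lambda>x. c * f x) = (\<lambda>e. c * specialise l f e)"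
proof
  fix e :: "nat list set \<times> nat list set"
  have F: "finite {x. f x \<noteq> 0}" using f by (auto simp: contracted_algebra_def)
  have "specialise l (\<lambda>x. c * f x) e = (\<Sum>z | f z \<noteq> 0. c * f z * weight l z e)"
    unfolding specialise_weighted_sum[OF algebra_closed(2)[OF f f]]
    by (rule weighted_sum_superset[OF F]) auto
  then show "specialise l (\<lambda>x. c * f x) e = c * specialise l f e"
    unfolding specialise_weighted_sum[OF f] by (simp only: sum_distrib_left mult.assoc)
qed

lemma specialise_mult:
  assumes f: "f \<in> hk_algebra n i" and g: "g \<in> hk_algebra n i"
  shows "specialise l (hk_algebra_mult n i f g)
    = munn_mult A B (eval_sandwich n i P l) (specialise l f) (specialise l g)"
proof
  fix e :: "nat list set \<times> nat list set"
  obtain a b where e: "e = (a, b)" by (cases e)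
  let ?Q = "eval_sandwich n i P l"
  let ?F = "{x. f x \<noteq> 0}" and ?G = "{x. g x \<noteq> 0}"
  have F: "finite ?F" "finite ?G" "\<And>x. f x \<noteq> 0 \<Longrightarrow> x \<in> hk_M n i" "\<And>x. g x \<noteq> 0 \<Longrightarrow> x \<in> hk_M n i"
    using f g unfolding contracted_algebra_def by blast+
  have swap: "(\<Sum>x\<in>X. \<Sum>b'\<in>B. \<Sum>a'\<in>A. h x b' a') = (\<Sum>b'\<in>B. \<Sum>a'\<in>A. \<Sum>x\<in>X. h x b' a')"
    for X :: "nat list set option set" and h :: "_ \<Rightarrow> _ \<Rightarrow> _ \<Rightarrow> 'a"
    by (rule HOL.trans[OF sum.swap], intro sum.cong HOL.refl, rule sum.swap)
  have "specialise l (hk_algebra_mult n i f g) e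
      = (\<Sum>x\<in>?F. \<Sum>y\<in>?G. f x * g y * weight l (x \<otimes>\<^bsub>hk_quotient n i\<^esub> y) e)"
    unfolding specialise_weighted_sum[OF algebra_closed(3)[OF f g]]
    by (rule contracted_mult_weighted_sum(1)[where w = "\<lambda>z. weight l z e", OF F(1,2) weight_None])
  also have "\<dots> = (\<Sum>x\<in>?F. \<Sum>y\<in>?G. \<Sum>b'\<in>B. \<Sum>a'\<in>A.
      (f x * weight l x (a, b')) * ?Q b' a' * (g y * weight l y (a', b)))"
    using F(3,4) by (intro sum.cong HOL.refl)
      (auto simp: weight_mult e munn_mult_def sum_distrib_left algebra_simps intro!: sum.cong)
  also have "\<dots> = (\<Sum>x\<in>?F. \<Sum>b'\<in>B. \<Sum>a'\<in>A. \<Sum>y\<in>?G.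
      (f x * weight l x (a, b')) * ?Q b' a' * (g y * weight l y (a', b)))"
    by (intro sum.cong HOL.refl swap)
  also have "\<dots> = (\<Sum>b'\<in>B. \<Sum>a'\<in>A. \<Sum>x\<in>?F. \<Sum>y\<in>?G.
      (f x * weight l x (a, b')) * ?Q b' a' * (g y * weight l y (a', b)))"
    by (rule swap)
  also have "\<dots> = munn_mult A B ?Q (specialise l f) (specialise l g) e"
    unfolding munn_mult_def e prod.case specialise_weighted_sum[OF f] specialise_weighted_sum[OF g]
    unfolding sum_distrib_left sum_distrib_right by (intro sum.cong HOL.refl sum.swap)
  finally show "specialise l (hk_algebra_mult n i f g) e = munn_mult A B ?Q (specialise l f) (specialise l g) e" .
qed

text \<open>Because \<open>\<lambda>\<close> is invertible, elements of degree one suffice: \<open>X\<close> is the image of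
  \<open>\<Sum> (X (a, b) / \<lambda>) a s\<^sub>i b\<close>.\<close>

lemma specialise_surj:
  fixes l :: "'k::field"
  assumes l: "l \<noteq> 0"
  shows "specialise l ` hk_algebra n i = munn_algebra A B"
proof (intro equalityI subsetI)
  fix X :: "nat list set \<times> nat list set \<Rightarrow> 'k" assume X: "X \<in> munn_algebra A B"
  define f where "f z = (case (if z \<in> hk_M n i then decode z else None) of
      Some (x, a, b) \<Rightarrow> if x = s then X (a, b) / l else 0 | None \<Rightarrow> 0)" for z
  have f_triple: "f (hk_triple n i (Some (x, a, b))) = (if x = s then X (a, b) / l else 0)"
    if "x \<in> hk_S n i" "a \<in> A" "b \<in> B" for x a b
  proof -
    have "Some (x, a, b) \<in> T" using that by (simp add: matrix_type_carrier_def)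
    then show ?thesis by (simp add: f_def decode_triple triple_in_M)
  qed
  have f_None: "f None = 0"
    using decode_triple[OF triple_None(1)] by (simp add: f_def triple_None)
  have s1: "s [^]\<^bsub>G\<^esub> (1::nat) = s"
    using Group.monoid.l_one[OF monoid_hk_monoid hk_s_closed[OF n i]] by simp
  have sS: "s \<in> hk_S n i" unfolding hk_S_def by (subst s1[symmetric]) blast
  have exp_s: "hk_exp n i s = 1" using exp_power[of 1] by (simp only: s1)
  have "{z. f z \<noteq> 0} \<subseteq> (\<lambda>(a, b). hk_triple n i (Some (s, a, b))) ` (A \<times> B)"
  proof
    fix z assume "z \<in> {z. f z \<noteq> 0}"
    then have z: "f z \<noteq> 0" by simp
    then have "z \<in> hk_M n i" by (auto simp: f_def split: if_splits)
    then obtain u where u: "u \<in> T" "z = hk_triple n i u" using M_cases by metis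
    moreover have "u \<noteq> None"
    proof
      assume "u = None"
      then have "z = None" using u(2) triple_None(2) by simp
      then show False using z f_None by simp
    qed
    ultimately obtain x a b where xab: "u = Some (x, a, b)" "x \<in> hk_S n i" "a \<in> A" "b \<in> B"
      by (auto simp: matrix_type_carrier_def)
    then have "x = s" using z f_triple u(2) by (simp split: if_splits)
    then show "z \<in> (\<lambda>(a, b). hk_triple n i (Some (s, a, b))) ` (A \<times> B)"
      using xab u(2) by auto
  qed
  then have "finite {z. f z \<noteq> 0}" by (rule finite_subset) (simp add: fin)
  moreover have "f z = 0" if "z \<notin> hk_M n i - {None}" for z
    using that f_None by (cases "z = None") (auto simp: f_def)
  ultimately have "f \<in> hk_algebra n i" by (simp add: contracted_algebra_def)
  moreover have "specialise l f = X"
  proof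
    fix e :: "nat list set \<times> nat list set"
    obtain a b where e: "e = (a, b)" by (cases e)
    show "specialise l f e = X e"
    proof (cases "a \<in> A \<and> b \<in> B")
      case True
      then have "{x. x \<in> hk_S n i \<and> f (hk_triple n i (Some (x, a, b))) \<noteq> 0} = (if X (a, b) = 0 then {} else {s})"
        using sS l by (auto simp: f_triple split: if_splits)
      then show ?thesis using True l sS by (simp add: e specialise_pointwise f_triple exp_s)
    next
      case False
      then show ?thesis using X by (auto simp: e specialise_pointwise munn_algebra_def)
    qed
  qed
  ultimately show "X \<in> specialise l ` hk_algebra n i" by blast
qed (auto simp: munn_algebra_def specialise_pointwise)

lemma eval_sandwich_nonzero:
  "(l::'k::field) \<noteq> 0 \<Longrightarrow> eval_sandwich n i P l \<one>\<^bsub>G\<^esub> \<one>\<^bsub>G\<^esub> \<noteq> 0"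
  using sandwich_one_one by (auto simp: eval_sandwich_eq split: option.split)

lemma specialise_compose:
  assumes "surj_alg_hom (munn_algebra A B) (munn_mult A B (eval_sandwich n i P l)) r h" "l \<noteq> 0"
  shows "irreducible_rep n i r (\<lambda>f. h (specialise l f))"
  unfolding irreducible_rep_def
proof (rule surj_alg_hom_compose[where E = "specialise l" and h = h])
  show "surj_alg_hom (munn_algebra A B) (munn_mult A B (eval_sandwich n i P l)) r h"
    by (fact assms(1))
  show "specialise l ` hk_algebra n i = munn_algebra A B"
    by (rule specialise_surj[OF assms(2)])
qed (simp_all only: specialise_add specialise_smult specialise_mult)

end

section \<open>The representations induced from the cyclic group\<close>

theorem proposition5p1:
  fixes n i :: nat
    and A B :: "nat list set set"
    and P :: "nat list set \<Rightarrow> nat list set \<Rightarrow> nat list set option"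
  assumes "n \<ge> 3" and "i \<le> n - 2"
    and "hk_matrix_type n i A B P"
  shows "\<forall>l :: 'k :: alg_closed_field. l \<noteq> 0 \<longrightarrow>
    (\<exists>r \<psi>. 1 \<le> r \<and> r \<le> card A \<and>
      irreducible_rep n i r \<psi> \<and> induced_rep n i A B P l r \<psi> \<and>
      (\<forall>r' \<psi>'. 1 \<le> r' \<and> irreducible_rep n i r' \<psi>' \<and> induced_rep n i A B P l r' \<psi>' \<longrightarrow>
        equivalent_reps (hk_algebra n i) r \<psi> r' \<psi>'))"
proof (intro allI impI)
  fix l :: 'k assume l: "l \<noteq> 0"
  interpret hk_matrix_data n i A B P using assms by unfold_locales
  let ?V = "munn_algebra A B :: (nat list set \<times> nat list set \<Rightarrow> 'k) set"
  let ?mul = "munn_mult A B (eval_sandwich n i P l)"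
  obtain r h0 where r: "1 \<le> r" "r \<le> card A" and h0: "surj_alg_hom ?V ?mul r h0"
    and equiv: "\<forall>r' h. surj_alg_hom ?V ?mul r' h \<longrightarrow> 1 \<le> r' \<longrightarrow> equivalent_reps ?V r h0 r' h"
    by (rule munn_algebra_unique_surj_hom[where Q = "eval_sandwich n i P l",
          OF fin one_in(2,1) eval_sandwich_nonzero[OF l]])
  have spec: "specialise l f \<in> ?V" if "f \<in> hk_algebra n i" for f
    using imageI[OF that, of "specialise l"] specialise_surj[OF l] by simp
  show "\<exists>r \<psi>. 1 \<le> r \<and> r \<le> card A \<and>
      irreducible_rep n i r \<psi> \<and> induced_rep n i A B P l r \<psi> \<and>
      (\<forall>r' \<psi>'. 1 \<le> r' \<and> irreducible_rep n i r' \<psi>' \<and> induced_rep n i A B P l r' \<psi>' \<longrightarrow>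
        equivalent_reps (hk_algebra n i) r \<psi> r' \<psi>')"
  proof (intro exI conjI allI impI)
    show "1 \<le> r" "r \<le> card A" by (fact r)+
    show "irreducible_rep n i r (\<lambda>f. h0 (specialise l f))" by (rule specialise_compose[OF h0 l])
    show "induced_rep n i A B P l r (\<lambda>f. h0 (specialise l f))"
      unfolding induced_rep_def using h0 by blast
    fix r' and \<psi>' :: "(nat list set option \<Rightarrow> 'k) \<Rightarrow> 'k mat"
    assume *: "1 \<le> r' \<and> irreducible_rep n i r' \<psi>' \<and> induced_rep n i A B P l r' \<psi>'"
    then obtain h where h: "surj_alg_hom ?V ?mul r' h"
      and \<psi>': "\<And>f. f \<in> hk_algebra n i \<Longrightarrow> \<psi>' f = h (specialise l f)"
      unfolding induced_rep_def by blast
    show "equivalent_reps (hk_algebra n i) r (\<lambda>f. h0 (specialise l f)) r' \<psi>'"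
    proof -
      have "equivalent_reps ?V r h0 r' h" using equiv h * by blast
      then obtain Q Q' where "r = r'" "Q \<in> carrier_mat r r" "Q' \<in> carrier_mat r r"
          "Q * Q' = 1\<^sub>m r \<and> Q' * Q = 1\<^sub>m r" and conj: "\<forall>X\<in>?V. h X = Q * h0 X * Q'"
        unfolding equivalent_reps_def by blast
      moreover have "\<forall>f\<in>hk_algebra n i. \<psi>' f = Q * h0 (specialise l f) * Q'"
        using \<psi>' bspec[OF conj spec] by simp
      ultimately show ?thesis
        unfolding equivalent_reps_def by (intro conjI bexI[of _ Q] bexI[of _ Q']) simp_all
    qed
  qed
qed

end
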